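(* Let $p$ be either a good odd prime or $p=23$, and let $x\in\mathbb{Z}_p\setminus\{-1,0,1,2,\dots\}$. Then $\bar f(x)$ is not $p$-definable, where $f(n)=\sum_{k=0}^n\binom nk^{-1}$.
   Context: $\nu_p$ denotes the exponent of $p$ in a rational number. A prime $p$ is called good if $\nu_p(f(n))\le1$ for all integers $n$ with $1\le n\le p-2$. For $x=\sum_{i\ge0}\varepsilon_ip^i\in\mathbb{Z}_p$ with $\varepsilon_i\in\{0,\dots,p-1\}$, let $x_n=\sum_{i=0}^n\varepsilon_ip^i$. One says $\bar f(x)$ is $p$-definable if $\lim_{n\to\infty}f(x_n)$ exists in $\mathbb{Q}_p$, and then $\bar f(x)$ is this limit. *)

theory Defs
  imports Complex_Main "HOL-Computational_Algebra.Primes"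
begin

section \<open>The sum of reciprocals of binomial coefficients, and good primes\<close>

definition inv_binom_sum :: "nat \<Rightarrow> rat" where
  "inv_binom_sum n = (\<Sum>k = 0..n. inverse (of_nat (n choose k)))"

text \<open>Exponent of \<open>p\<close> in a rational number, from the reduced fraction given by
  \<^const>\<open>quotient_of\<close>. The value at \<open>0\<close> is the junk value \<open>0\<close>; the absolute value below treats
  \<open>0\<close> separately, and \<^const>\<open>inv_binom_sum\<close> is always positive.\<close>

definition padic_val :: "nat \<Rightarrow> rat \<Rightarrow> int" where
  "padic_val p q =
     int (multiplicity (int p) (fst (quotient_of q))) -
     int (multiplicity (int p) (snd (quotient_of q)))"

definition good_prime :: "nat \<Rightarrow> bool" where
  "good_prime p \<longleftrightarrow> prime p \<and> (\<forall>n\<in>{1..p - 2}. padic_val p (inv_binom_sum n) \<le> 1)"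


section \<open>The p-adic numbers as the completion of the rationals\<close>

definition padic_abs :: "nat \<Rightarrow> rat \<Rightarrow> real" where
  "padic_abs p q = (if q = 0 then 0 else real p powi (- padic_val p q))"

definition padic_Cauchy :: "nat \<Rightarrow> (nat \<Rightarrow> rat) \<Rightarrow> bool" where
  "padic_Cauchy p u \<longleftrightarrow>
     (\<forall>e>0. \<exists>N. \<forall>m\<ge>N. \<forall>n\<ge>N. padic_abs p (u m - u n) < e)"

definition padic_rel :: "nat \<Rightarrow> ((nat \<Rightarrow> rat) \<times> (nat \<Rightarrow> rat)) set" where
  "padic_rel p = {(u, v). padic_Cauchy p u \<and> padic_Cauchy p v \<and>
     (\<lambda>n. padic_abs p (u n - v n)) \<longlonglongrightarrow> 0}"

text \<open>A \<open>p\<close>-adic number is an equivalence class of \<open>p\<close>-adic Cauchy sequences of rationals modulo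
  null sequences. Since \<open>p\<close> is a term, \<open>\<rat>\<^sub>p\<close> is a set of such classes and not a type.\<close>

type_synonym padic = "(nat \<Rightarrow> rat) set"

definition padic_field :: "nat \<Rightarrow> padic set" where
  "padic_field p = {u. padic_Cauchy p u} // padic_rel p"

definition padic_of_rat :: "nat \<Rightarrow> rat \<Rightarrow> padic" where
  "padic_of_rat p q = padic_rel p `` {\<lambda>_. q}"

text \<open>The extension of the metric \<open>|a - b|\<^sub>p\<close> to the completion; the limit exists and does not depend
  on the representatives.\<close>

definition padic_dist :: "nat \<Rightarrow> padic \<Rightarrow> padic \<Rightarrow> real" where
  "padic_dist p X Y =
     (THE d. \<exists>u\<in>X. \<exists>v\<in>Y. (\<lambda>n. padic_abs p (u n - v n)) \<longlonglongrightarrow> d)"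

definition padic_tendsto :: "nat \<Rightarrow> (nat \<Rightarrow> padic) \<Rightarrow> padic \<Rightarrow> bool" where
  "padic_tendsto p X L \<longleftrightarrow> (\<lambda>n. padic_dist p (X n) L) \<longlonglongrightarrow> 0"

definition padic_integers :: "nat \<Rightarrow> padic set" where
  "padic_integers p = {x \<in> padic_field p. padic_dist p x (padic_of_rat p 0) \<le> 1}"


section \<open>Digit expansions and p-definability\<close>

text \<open>The unique digit sequence \<open>\<epsilon>\<close> with \<open>x = (\<Sum>i. \<epsilon> i * p ^ i)\<close> in \<open>\<int>\<^sub>p\<close>,
  and the truncation \<open>x\<^sub>n\<close>, which includes the digit with index \<open>n\<close>.\<close>

definition padic_digits :: "nat \<Rightarrow> padic \<Rightarrow> nat \<Rightarrow> nat" where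
  "padic_digits p x = (THE \<epsilon>. (\<forall>i. \<epsilon> i \<in> {0..<p}) \<and>
     padic_tendsto p (\<lambda>n. padic_of_rat p (of_nat (\<Sum>i\<le>n. \<epsilon> i * p ^ i))) x)"

definition padic_trunc :: "nat \<Rightarrow> padic \<Rightarrow> nat \<Rightarrow> nat" where
  "padic_trunc p x n = (\<Sum>i\<le>n. padic_digits p x i * p ^ i)"

definition p_definable :: "nat \<Rightarrow> (nat \<Rightarrow> rat) \<Rightarrow> padic \<Rightarrow> bool" where
  "p_definable p f x \<longleftrightarrow>
     (\<exists>L\<in>padic_field p. padic_tendsto p (\<lambda>n. padic_of_rat p (f (padic_trunc p x n))) L)"

end

theory Submission
  imports Defs "HOL-Number_Theory.Number_Theory"
begin

text \<open>Write \<open>f n = (n + 1) / 2 ^ (n + 1) * S (n + 1)\<close> with \<open>S m = (\<Sum>j = 1..m. 2 ^ j / j)\<close>, and let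
  \<open>M = x\<^sub>n + 1\<close>. The terms of \<open>S M\<close> with the highest power of \<open>p\<close> in the denominator show that
  \<open>p ^ n * S M\<close> is congruent to \<open>S d\<close> modulo \<open>p\<close>, where \<open>d\<close> is the leading digit of \<open>M\<close>. Using one
  digit \<open>e\<close> more, \<open>p ^ (n - 1) * S M\<close> is congruent to \<open>S d / p + 2 ^ d * S e\<close>. Suppose that \<open>p\<close> is
  good and divides \<open>S d\<close>, so that \<open>S d / p\<close> is a unit. If \<open>p\<close> divides \<open>S e\<close> as well, the sum is
  a unit; otherwise \<open>S\<close> is already large at the previous truncation. For \<open>p = 23\<close> the only
  exceptional leading digit is \<open>13\<close>, and there a finite computation with three digits suffices.
  Since \<open>x \<noteq> -1\<close>, the factor \<open>M\<close> has bounded valuation, so \<open>f\<close> is unbounded along the truncations.\<close>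

section \<open>The p-adic absolute value\<close>

text \<open>Stripping a factor p from the summation index of \<open>S\<close> replaces the base 2 by
  2^p, so the base has to be variable. Modulo p this change is invisible by Fermat's theorem, but
  the formula with a second digit contains a division by p and needs the base modulo p^2, where 2^p
  and 2 may differ. The Fermat quotient that arises is cancelled by the complete blocks of indices
  prime to p; this is why only \<open>S d\<close> and \<open>S e\<close> remain. The prime 23 is not
  good: \<open>S 13\<close> equals 62836736/45045, and 23^2 divides the numerator. So
  \<open>S 13 / 23\<close> vanishes modulo 23, and the two-digit value is 0 for e = 0 and e = 13.
  Two digits decide nothing there; the third digit is examined modulo 23^3. Excluding the
  nonnegative integers provides nonzero leading digits arbitrarily far out. Excluding -1 provides a
  digit other than p - 1, which also stops the carry in x_n + 1, so that M inherits the leading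
  digits of x.\<close>

locale prime_base =
  fixes p :: nat
  assumes prime_p: "prime p"
begin

abbreviation pabs :: "rat \<Rightarrow> real" where "pabs \<equiv> padic_abs p"

lemma p_gt_1: "1 < real p"
  using prime_gt_1_nat[OF prime_p] by simp

lemma prime_int_p: "prime (int p)"
  using prime_p by simp

text \<open>Cross-multiplication with the reduced fraction shows that the valuation does not depend
  on the representing fraction, so later computations are free to use any common
  denominator.\<close>

lemma padic_val_divide_of_int:
  assumes "a \<noteq> 0" "b \<noteq> 0"
  shows "padic_val p (of_int a / of_int b) =
    int (multiplicity (int p) a) - int (multiplicity (int p) b)"
proof -
  obtain n d where nd: "quotient_of (of_int a / of_int b) = (n, d)"
    by fastforce
  have d: "d > 0" using quotient_of_denom_pos[OF nd] .
  have "(of_int a / of_int b :: rat) = of_int n / of_int d"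
    using quotient_of_div[OF nd] .
  then have "(of_int (a * d) :: rat) = of_int (n * b)"
    using assms d by (simp add: field_simps)
  then have eq: "a * d = n * b" by (simp only: of_int_eq_iff)
  then have "n \<noteq> 0" using assms d by auto
  have pe: "prime_elem (int p)" using prime_int_p by blast
  have "multiplicity (int p) a + multiplicity (int p) d = multiplicity (int p) (a * d)"
    using prime_elem_multiplicity_mult_distrib[OF pe] assms d by simp
  also have "\<dots> = multiplicity (int p) n + multiplicity (int p) b"
    using prime_elem_multiplicity_mult_distrib[OF pe] assms \<open>n \<noteq> 0\<close> eq by simp
  finally show ?thesis by (simp add: padic_val_def nd)
qed

lemma rat_cases:
  fixes x :: rat
  obtains a b :: int where "x = of_int a / of_int b" "b \<noteq> 0"
  using quotient_of_div[of x] quotient_of_denom_pos[of x] by (cases "quotient_of x") auto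

lemma padic_abs_0 [simp]: "pabs 0 = 0"
  by (simp add: padic_abs_def)

lemma padic_abs_pos: "x \<noteq> 0 \<Longrightarrow> 0 < pabs x"
  using p_gt_1 by (simp add: padic_abs_def)

lemma padic_abs_nonneg [simp]: "0 \<le> pabs x"
  using p_gt_1 by (simp add: padic_abs_def)

lemma padic_abs_eq_0_iff [simp]: "pabs x = 0 \<longleftrightarrow> x = 0"
  using padic_abs_pos[of x] by (cases "x = 0") auto

lemma padic_abs_mult: "pabs (x * y) = pabs x * pabs y"
proof (cases "x = 0 \<or> y = 0")
  case False
  obtain a b where x: "x = of_int a / of_int b" "b \<noteq> 0" by (rule rat_cases)
  obtain c d where y: "y = of_int c / of_int d" "d \<noteq> 0" by (rule rat_cases)
  have ac: "a \<noteq> 0" "c \<noteq> 0" using False x y by auto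
  have pe: "prime_elem (int p)" using prime_int_p by blast
  have "padic_val p (x * y) = padic_val p (of_int (a * c) / of_int (b * d))"
    by (simp add: x y)
  also have "\<dots> = padic_val p x + padic_val p y"
    using ac x(2) y(2) unfolding x(1) y(1)
    by (subst (1 2 3) padic_val_divide_of_int)
      (auto simp: prime_elem_multiplicity_mult_distrib[OF pe])
  finally show ?thesis
    using False p_gt_1 by (simp add: padic_abs_def power_int_add[symmetric])
qed auto

lemma padic_abs_of_int:
  assumes "a \<noteq> 0"
  shows "pabs (of_int a) = 1 / real p ^ multiplicity (int p) a"
  using padic_val_divide_of_int[OF assms, of 1] assms
  by (simp add: padic_abs_def power_int_minus field_simps)

lemma padic_abs_of_int_le_iff: "pabs (of_int a) \<le> 1 / real p ^ k \<longleftrightarrow> int p ^ k dvd a"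
proof (cases "a = 0")
  case False
  have "real p ^ k \<le> real p ^ multiplicity (int p) a \<longleftrightarrow> k \<le> multiplicity (int p) a"
    using p_gt_1 by simp
  moreover have "pabs (of_int a) \<le> 1 / real p ^ k \<longleftrightarrow>
      real p ^ k \<le> real p ^ multiplicity (int p) a"
    using p_gt_1 by (simp add: padic_abs_of_int[OF False] field_simps)
  ultimately show ?thesis
    using power_dvd_iff_le_multiplicity[of a "int p" k] False prime_int_p
      p_gt_1 by auto
qed (use p_gt_1 in auto)

lemma padic_abs_of_int_le_1: "pabs (of_int a) \<le> 1"
  using padic_abs_of_int_le_iff[of a 0] by simp

lemma padic_abs_of_int_unit:
  assumes "\<not> int p dvd a"
  shows "pabs (of_int a) = 1"
  using assms by (cases "a = 0") (auto simp: padic_abs_of_int not_dvd_imp_multiplicity_0)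

lemma padic_abs_of_nat_unit: "\<not> p dvd n \<Longrightarrow> pabs (of_nat n) = 1"
  using padic_abs_of_int_unit[of "int n"] by simp

lemma padic_abs_1 [simp]: "pabs 1 = 1"
  using padic_abs_of_int[of 1] by simp

lemma padic_abs_p [simp]: "pabs (of_nat p) = 1 / real p"
proof -
  have "p \<noteq> 0" using p_gt_1 by auto
  then show ?thesis
    using padic_abs_of_int[of "int p"] multiplicity_self[of "int p"] prime_int_p by auto
qed

lemma padic_abs_power: "pabs (x ^ n) = pabs x ^ n"
  by (induction n) (simp_all add: padic_abs_mult)

lemma padic_abs_inverse: "pabs (inverse x) = inverse (pabs x)"
proof (cases "x = 0")
  case False
  then have "pabs (inverse x) * pabs x = 1"
    by (simp flip: padic_abs_mult)
  then show ?thesis using False by (simp add: field_simps)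
qed simp

lemma padic_abs_divide: "pabs (x / y) = pabs x / pabs y"
  by (simp add: divide_inverse padic_abs_mult padic_abs_inverse)

lemma padic_abs_minus [simp]: "pabs (- x) = pabs x"
proof -
  have "pabs (-1) = 1"
    using padic_abs_of_int_unit[of "-1"] not_prime_unit prime_int_p by auto
  then show ?thesis using padic_abs_mult[of "-1" x] by simp
qed

lemma padic_abs_minus_commute: "pabs (x - y) = pabs (y - x)"
  using padic_abs_minus[of "x - y"] by simp

lemma padic_abs_eq_powi: "x \<noteq> 0 \<Longrightarrow> \<exists>k. pabs x = real p powi k"
  by (auto simp: padic_abs_def)

lemma padic_abs_add: "pabs (x + y) \<le> max (pabs x) (pabs y)"
proof -
  obtain a b where x: "x = of_int a / of_int b" "b \<noteq> 0" by (rule rat_cases)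
  obtain c d where y: "y = of_int c / of_int d" "d \<noteq> 0" by (rule rat_cases)
  define u v where "u = a * d" and "v = c * b"
  have x': "x = of_int u / of_int (b * d)" and y': "y = of_int v / of_int (b * d)"
    using x y by (auto simp: u_def v_def field_simps)
  have xy: "x + y = of_int (u + v) / of_int (b * d)"
    by (simp add: x' y' add_divide_distrib)
  have "pabs (of_int (u + v)) \<le> max (pabs (of_int u)) (pabs (of_int v))"
  proof (cases "u = 0 \<or> v = 0")
    case False
    define k where "k = min (multiplicity (int p) u) (multiplicity (int p) v)"
    have "int p ^ k dvd u" "int p ^ k dvd v"
      unfolding k_def by (rule multiplicity_dvd'; simp)+
    then have "pabs (of_int (u + v)) \<le> 1 / real p ^ k"
      by (subst padic_abs_of_int_le_iff) simp
    also have "\<dots> \<le> max (pabs (of_int u)) (pabs (of_int v))"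
      using False by (auto simp: padic_abs_of_int k_def min_def)
    finally show ?thesis .
  qed auto
  then have "pabs (of_int (u + v)) / pabs (of_int (b * d)) \<le>
      max (pabs (of_int u) / pabs (of_int (b * d))) (pabs (of_int v) / pabs (of_int (b * d)))"
    unfolding le_max_iff_disj by (elim disj_forward) (simp_all add: divide_right_mono)
  then show ?thesis
    unfolding xy unfolding x' y' padic_abs_divide .
qed

lemma padic_abs_diff: "pabs (x - y) \<le> max (pabs x) (pabs y)"
  using padic_abs_add[of x "- y"] by simp

lemma padic_abs_triangle: "pabs (x - z) \<le> max (pabs (x - y)) (pabs (y - z))"
  using padic_abs_add[of "x - y" "y - z"] by simp

lemma padic_abs_diff_trans:
  "pabs (x - y) \<le> c \<Longrightarrow> pabs (y - z) \<le> c \<Longrightarrow> pabs (x - z) \<le> c"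
  using padic_abs_triangle[of x z y] by linarith

lemma padic_abs_add_le: "pabs x \<le> c \<Longrightarrow> pabs y \<le> c \<Longrightarrow> pabs (x + y) \<le> c"
  using padic_abs_add[of x y] by linarith

lemma padic_abs_sum_le:
  assumes "\<And>i. i \<in> I \<Longrightarrow> pabs (g i) \<le> c" "0 \<le> c"
  shows "pabs (\<Sum>i\<in>I. g i) \<le> c"
  using assms
proof (induction I rule: infinite_finite_induct)
  case (insert i I)
  then show ?case by (simp add: padic_abs_add_le)
qed auto

text \<open>In an ultrametric a perturbation smaller than x cannot change its absolute value. All
  dominant-term arguments below rest on this.\<close>

lemma padic_abs_eq_if_close: "pabs (x - y) < pabs x \<Longrightarrow> pabs y = pabs x"
  using padic_abs_add[of "x - y" y] padic_abs_diff[of x "x - y"]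
  by simp

text \<open>The value group is discrete: only integer powers of p occur, so a strict bound improves
  to the next power.\<close>

lemma padic_abs_less_imp_le:
  assumes "pabs x < 1 / real p ^ k"
  shows "pabs x \<le> 1 / real p ^ Suc k"
proof (cases "x = 0")
  case True
  then show ?thesis by simp
next
  case False
  then obtain e where e: "pabs x = real p powi e"
    using padic_abs_eq_powi by blast
  have "real p powi e < real p powi (- int k)"
    using assms e by (simp add: power_int_minus field_simps)
  then have "e < - int k"
    using power_int_increasing[of "- int k" e "real p"] p_gt_1 by (cases "e < - int k") auto
  then have "e \<le> - int (Suc k)" by simp
  then have "real p powi e \<le> real p powi (- int (Suc k))"
    using p_gt_1 by (intro power_int_increasing) auto
  then show ?thesis
    by (simp only: e power_int_minus power_int_of_nat inverse_eq_divide)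
qed

lemma padic_abs_less_1_imp_le: "pabs x < 1 \<Longrightarrow> pabs x \<le> 1 / real p"
  using padic_abs_less_imp_le[of x 0] by simp

end

section \<open>Sums of reciprocals of binomial coefficients and truncated logarithms\<close>

text \<open>A truncation of the power series of -log(1 - t). The sum of interest has t = 2; the
  bases 2^(p^r) appear when factors of p are removed from the indices.\<close>

definition trunc_log :: "int \<Rightarrow> nat \<Rightarrow> rat" where
  "trunc_log t m = (\<Sum>j = 1..m. of_int t ^ j / of_nat j)"

lemma trunc_log_0 [simp]: "trunc_log t 0 = 0"
  by (simp add: trunc_log_def)

lemma trunc_log_Suc: "trunc_log t (Suc m) = trunc_log t m + of_int t ^ Suc m / of_nat (Suc m)"
  by (simp add: trunc_log_def)

text \<open>By absorption both reciprocals are multiples of the reciprocal of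
  \<open>n choose k\<close>, with numerators n + 1 - k and k + 1. Their sum n + 2 is free of k, so
  summing over k yields a recurrence.\<close>

lemma inverse_binomial_add:
  assumes "k \<le> n"
  shows "inverse (of_nat (Suc n choose k)) + inverse (of_nat (Suc n choose Suc k)) =
    (of_nat (n + 2) / of_nat (n + 1) * inverse (of_nat (n choose k)) :: rat)"
proof -
  define A where "A = (of_nat (n choose k) :: rat)"
  have A: "A \<noteq> 0" using assms by (simp add: A_def)
  have "(Suc n choose k) * (Suc n - k) = Suc n * (n choose k)"
    using binomial_absorb_comp[of "Suc n" k] by (simp add: mult.commute)
  then have "of_nat (Suc n choose k) * of_nat (Suc n - k) = (of_nat (Suc n) * A)"
    unfolding A_def of_nat_mult[symmetric] by (simp only:)
  then have 1: "of_nat (Suc n choose k) = of_nat (Suc n) * A / of_nat (Suc n - k)"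
    using assms by (simp add: field_simps)
  have "Suc k * (Suc n choose Suc k) = Suc n * (n choose k)"
    using Suc_times_binomial_eq[of n k] by (simp only: mult.commute)
  then have "of_nat (Suc k) * of_nat (Suc n choose Suc k) = (of_nat (Suc n) * A)"
    unfolding A_def of_nat_mult[symmetric] by (simp only:)
  then have 2: "of_nat (Suc n choose Suc k) = of_nat (Suc n) * A / of_nat (Suc k)"
    by (simp add: field_simps del: of_nat_Suc)
  have "inverse (of_nat (Suc n choose k)) + inverse (of_nat (Suc n choose Suc k)) =
      (of_nat (Suc n - k) + of_nat (Suc k)) / (of_nat (Suc n) * A)"
    unfolding 1 2 by (simp add: add_divide_distrib)
  also have "of_nat (Suc n - k) + of_nat (Suc k) = (of_nat (n + 2) :: rat)"
    using assms by (simp flip: of_nat_add)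
  finally show ?thesis by (simp add: A_def divide_inverse)
qed

text \<open>Each of the two shifted sums covers row n + 1 except for one end term equal to 1; this
  accounts for the factor 2 and the summand 1.\<close>

lemma inv_binom_sum_Suc:
  "inv_binom_sum (Suc n) = of_nat (n + 2) / (2 * of_nat (n + 1)) * inv_binom_sum n + 1"
proof -
  define g where "g k = (inverse (of_nat (Suc n choose k)) :: rat)" for k
  have "(\<Sum>k\<le>n. g k + g (Suc k)) = of_nat (n + 2) / of_nat (n + 1) * inv_binom_sum n"
    unfolding inv_binom_sum_def g_def sum_distrib_left atLeast0AtMost
    by (rule sum.cong) (use inverse_binomial_add in auto)
  moreover have "(\<Sum>k\<le>n. g k) = inv_binom_sum (Suc n) - 1"
    unfolding inv_binom_sum_def g_def atLeast0AtMost by simp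
  moreover have "(\<Sum>k\<le>n. g (Suc k)) = inv_binom_sum (Suc n) - 1"
    unfolding inv_binom_sum_def g_def atLeast0AtMost by (subst sum.atMost_Suc_shift) simp
  ultimately have "2 * (inv_binom_sum (Suc n) - 1) =
      of_nat (n + 2) / of_nat (n + 1) * inv_binom_sum n"
    by (simp add: sum.distrib)
  then show ?thesis by (simp add: field_simps)
qed

lemma inv_binom_sum_eq_trunc_log:
  "inv_binom_sum n = of_nat (Suc n) / 2 ^ Suc n * trunc_log 2 (Suc n)"
proof (induction n)
  case 0
  then show ?case by (simp add: inv_binom_sum_def trunc_log_Suc)
next
  case (Suc n)
  have "of_nat (n + 2) / (2 * of_nat (n + 1)) * (of_nat (Suc n) / 2 ^ Suc n * T) + 1 =
      of_nat (Suc (Suc n)) / 2 ^ Suc (Suc n) * (T + 2 ^ Suc (Suc n) / of_nat (Suc (Suc n)))"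
    for T :: rat
    by (simp add: divide_simps del: power_Suc of_nat_Suc of_nat_add) (simp add: algebra_simps)
  then show ?case
    unfolding inv_binom_sum_Suc Suc by (subst (2) trunc_log_Suc) simp
qed

section \<open>Congruences between rationals modulo powers of p\<close>

context prime_base
begin

text \<open>Congruence modulo p^k, meaningful also for rationals with p in the denominator, such as
  \<open>trunc_log 2 d / of_nat p\<close>.\<close>

definition pcong :: "nat \<Rightarrow> rat \<Rightarrow> rat \<Rightarrow> bool" where
  "pcong k x y \<longleftrightarrow> pabs (x - y) \<le> 1 / real p ^ k"

lemma pcong_refl [simp]: "pcong k x x"
  by (simp add: pcong_def)

lemma pcong_sym: "pcong k x y \<Longrightarrow> pcong k y x"
  by (simp add: pcong_def padic_abs_minus_commute)

lemma pcong_trans [trans]: "pcong k x y \<Longrightarrow> pcong k y z \<Longrightarrow> pcong k x z"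
  unfolding pcong_def by (rule padic_abs_diff_trans)

lemma pcong_add: "pcong k x x' \<Longrightarrow> pcong k y y' \<Longrightarrow> pcong k (x + y) (x' + y')"
  unfolding pcong_def using padic_abs_add_le[of "x - x'" _ "y - y'"]
  by (simp add: algebra_simps)

lemma pcong_diff: "pcong k x x' \<Longrightarrow> pcong k y y' \<Longrightarrow> pcong k (x - y) (x' - y')"
  unfolding pcong_def using padic_abs_add_le[of "x - x'" _ "y' - y"]
  by (simp add: algebra_simps padic_abs_minus_commute)

lemma pcong_sum: "(\<And>i. i \<in> I \<Longrightarrow> pcong k (g i) (h i)) \<Longrightarrow> pcong k (sum g I) (sum h I)"
  unfolding pcong_def sum_subtractf[symmetric] by (rule padic_abs_sum_le) auto

lemma pcong_mult_left: "pcong k x y \<Longrightarrow> pabs c \<le> 1 \<Longrightarrow> pcong k (c * x) (c * y)"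
  unfolding pcong_def right_diff_distrib[symmetric] padic_abs_mult
  using mult_mono[of "pabs c" 1 "pabs (x - y)"] by simp

lemma pcong_mult:
  assumes "pcong k x x'" "pcong k y y'" "pabs x \<le> 1" "pabs y' \<le> 1"
  shows "pcong k (x * y) (x' * y')"
  using pcong_mult_left[OF assms(2,3)] pcong_mult_left[OF assms(1,4)]
  by (auto simp: mult.commute intro: pcong_trans)

lemma pcong_mono: "pcong k x y \<Longrightarrow> l \<le> k \<Longrightarrow> pcong l x y"
  unfolding pcong_def
  using p_gt_1 by (meson order_trans divide_left_mono power_increasing zero_less_power
      less_imp_le mult_pos_pos zero_le_one less_trans zero_less_one)

lemma pcong_p_mult_iff: "pcong (Suc k) (of_nat p * x) (of_nat p * y) \<longleftrightarrow> pcong k x y"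
  unfolding pcong_def right_diff_distrib[symmetric] padic_abs_mult padic_abs_p
  using p_gt_1 by (simp add: field_simps)

lemma pcong_div_p: "pcong (Suc k) x y \<Longrightarrow> pcong k (x / of_nat p) (y / of_nat p)"
  using pcong_p_mult_iff[of k "x / of_nat p" "y / of_nat p"] p_gt_1 by simp

lemma pcong_2_p_mult: "pcong 1 x y \<Longrightarrow> pcong 2 (of_nat p * x) (of_nat p * y)"
  using pcong_p_mult_iff[of 1] by (simp add: numeral_2_eq_2)

lemma pcong_2_div_p: "pcong 2 x y \<Longrightarrow> pcong 1 (x / of_nat p) (y / of_nat p)"
  using pcong_div_p[of 1] by (simp add: numeral_2_eq_2)

lemma pcong_of_int_iff: "pcong k (of_int a) (of_int b) \<longleftrightarrow> [a = b] (mod (int p ^ k))"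
  using padic_abs_of_int_le_iff[of "a - b" k] by (simp add: pcong_def cong_iff_dvd_diff)

lemma pcong_1_of_int_iff: "pcong 1 (of_int a) (of_int b) \<longleftrightarrow> [a = b] (mod (int p))"
  using pcong_of_int_iff[of 1] by simp

lemma pcong_abs_eq:
  assumes "pcong k x y" "1 / real p ^ k < pabs x"
  shows "pabs y = pabs x"
  using assms padic_abs_eq_if_close[of x y] by (simp add: pcong_def)

lemma pcong_unit_divide:
  assumes "pcong k x y" "pabs z = 1"
  shows "pcong k (x / z) (y / z)"
  using assms by (simp add: pcong_def padic_abs_divide flip: diff_divide_distrib)

lemma padic_abs_of_int_power_le_1: "pabs (of_int t ^ n) \<le> 1"
  using padic_abs_of_int_le_1[of "t ^ n"] by simp

lemma not_dvd_if_less: "0 < j \<Longrightarrow> j < p \<Longrightarrow> \<not> p dvd j"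
  by (auto dest: dvd_imp_le)

section \<open>Separation of the indices divisible by p\<close>

definition unit_sum :: "int \<Rightarrow> nat \<Rightarrow> rat" where
  "unit_sum t m = (\<Sum>j | j \<in> {1..m} \<and> \<not> p dvd j. of_int t ^ j / of_nat j)"

lemma unit_sum_0 [simp]: "unit_sum t 0 = 0"
  by (simp add: unit_sum_def)

lemma unit_sum_Suc: "unit_sum t (Suc m) =
  unit_sum t m + (if p dvd Suc m then 0 else of_int t ^ Suc m / of_nat (Suc m))"
proof -
  have "{j. j \<in> {1..Suc m} \<and> \<not> p dvd j} = (if p dvd Suc m then {} else {Suc m}) \<union>
      {j. j \<in> {1..m} \<and> \<not> p dvd j}"
    by (auto simp: le_Suc_eq)
  then show ?thesis
    unfolding unit_sum_def by (auto simp del: of_nat_Suc power_Suc)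
qed

lemma padic_abs_unit_sum: "pabs (unit_sum t m) \<le> 1"
  unfolding unit_sum_def
  by (rule padic_abs_sum_le)
    (auto simp: padic_abs_divide padic_abs_of_nat_unit padic_abs_of_int_power_le_1)

text \<open>The index j = p * i contributes (t^p)^i / i, divided by p; hence the new base.\<close>

lemma trunc_log_split:
  "trunc_log t m = trunc_log (t ^ p) (m div p) / of_nat p + unit_sum t m"
proof (induction m)
  case 0
  then show ?case by simp
next
  case (Suc m)
  show ?case
  proof (cases "p dvd Suc m")
    case True
    then obtain i where i: "Suc m = p * i" by blast
    have p: "0 < p" using p_gt_1 by simp
    have "0 < i" using i by (cases i) auto
    then obtain i' where i': "i = Suc i'" by (cases i) auto
    have "m div p = i'"
      using i i' p by (intro div_nat_eqI) (auto simp: algebra_simps)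
    moreover have "Suc m div p = Suc i'" using i i' p by simp
    moreover have "of_int t ^ Suc m / of_nat (Suc m) =
        of_int (t ^ p) ^ Suc i' / of_nat (Suc i') / (of_nat p :: rat)"
      unfolding i i' by (simp only: power_mult of_nat_mult of_int_power divide_divide_eq_left
          mult.commute[of "of_nat p"])
    ultimately show ?thesis
      using Suc True by (simp add: trunc_log_Suc unit_sum_Suc add_divide_distrib del: of_nat_Suc power_Suc)
  next
    case False
    then have "Suc m div p = m div p"
      using div_Suc[of m p] by (simp add: dvd_eq_mod_eq_0)
    then show ?thesis
      using Suc False by (simp add: trunc_log_Suc unit_sum_Suc del: of_nat_Suc power_Suc)
  qed
qed

text \<open>After each splitting the part prime to p is p-integral and is then multiplied by p, so
  modulo p only the indices divisible by p^r survive.\<close>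

lemma pcong_trunc_log_div:
  "pcong 1 (of_nat p ^ r * trunc_log t m) (trunc_log (t ^ p ^ r) (m div p ^ r))"
proof (induction r)
  case (Suc r)
  define T where "T = trunc_log (t ^ p ^ r) (m div p ^ r)"
  have "pcong 2 (of_nat p * (of_nat p ^ r * trunc_log t m)) (of_nat p * T)"
    using Suc pcong_p_mult_iff[of 1] by (simp add: T_def numeral_2_eq_2)
  then have "pcong 1 (of_nat p ^ Suc r * trunc_log t m) (of_nat p * T)"
    by (auto intro: pcong_mono simp: mult.assoc)
  also have "of_nat p * T = trunc_log (t ^ p ^ Suc r) (m div p ^ Suc r) +
      of_nat p * unit_sum (t ^ p ^ r) (m div p ^ r)"
  proof -
    have "m div p ^ r div p = m div p ^ Suc r"
      by (simp add: div_mult2_eq power_Suc2 del: power_Suc)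
    moreover have "(t ^ p ^ r) ^ p = t ^ p ^ Suc r"
      by (simp add: mult.commute flip: power_mult)
    ultimately show ?thesis
      unfolding T_def using p_gt_1
      by (subst trunc_log_split) (simp add: distrib_left del: power_Suc)
  qed
  also have "pcong 1 \<dots> (trunc_log (t ^ p ^ Suc r) (m div p ^ Suc r))"
    using padic_abs_unit_sum p_gt_1 by (simp add: pcong_def padic_abs_mult divide_right_mono)
  finally show ?case .
qed simp

lemma padic_abs_of_nat_ge:
  assumes "0 < j" "j < p ^ Suc l"
  shows "1 / real p ^ l \<le> pabs (of_nat j)"
proof -
  have "\<not> int p ^ Suc l dvd int j"
    using assms by (auto simp flip: of_nat_power simp del: power_Suc dest!: dvd_imp_le)
  then have "1 / real p ^ Suc l < pabs (of_nat j)"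
    using padic_abs_of_int_le_iff[of "int j" "Suc l"] by simp
  then show ?thesis
    using padic_abs_less_imp_le[of "of_nat j" l] by linarith
qed

lemma padic_abs_trunc_log_le:
  assumes "m < p ^ Suc l"
  shows "pabs (trunc_log t m) \<le> real p ^ l"
  unfolding trunc_log_def
proof (rule padic_abs_sum_le)
  fix j assume "j \<in> {1..m}"
  then have "pabs (of_int t ^ j) / pabs (of_nat j) \<le> 1 / (1 / real p ^ l)"
    using assms p_gt_1
    by (intro frac_le padic_abs_of_int_power_le_1 padic_abs_of_nat_ge) auto
  then show "pabs (of_int t ^ j / of_nat j) \<le> real p ^ l"
    by (simp add: padic_abs_divide)
qed simp

text \<open>For j < p^(l+1) division by j costs at most l powers of p, hence the extra l in the
  modulus.\<close>

lemma pcong_trunc_log_base: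
  assumes "[t = s] (mod (int p ^ (k + l)))" "m < p ^ Suc l"
  shows "pcong k (trunc_log t m) (trunc_log s m)"
  unfolding trunc_log_def
proof (rule pcong_sum)
  fix j assume j: "j \<in> {1..m}"
  have "pcong (k + l) (of_int (t ^ j)) (of_int (s ^ j))"
    unfolding pcong_of_int_iff using assms(1) by (rule cong_pow)
  then have 1: "pabs (of_int t ^ j - of_int s ^ j) \<le> 1 / real p ^ (k + l)"
    by (simp add: pcong_def)
  have "1 / real p ^ l \<le> pabs (of_nat j)"
    using j assms(2) by (intro padic_abs_of_nat_ge) auto
  then have "pabs (of_int t ^ j - of_int s ^ j) / pabs (of_nat j) \<le>
      (1 / real p ^ (k + l)) / (1 / real p ^ l)"
    using 1 p_gt_1 by (intro frac_le) auto
  also have "\<dots> = 1 / real p ^ k"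
    using p_gt_1 by (simp add: power_add)
  finally show "pcong k (of_int t ^ j / of_nat j) (of_int s ^ j / of_nat j)"
    by (simp add: pcong_def padic_abs_divide flip: diff_divide_distrib)
qed

lemma euler_theorem_int:
  assumes "coprime a (int m)"
  shows "[a ^ totient m = 1] (mod (int m))"
proof (cases "m \<le> 1")
  case True
  then show ?thesis by (cases m) auto
next
  case False
  then show ?thesis
    using residues.euler_theorem[of "int m" a] assms by (simp add: residues_def)
qed

lemma fermat_int: "[t ^ p = t] (mod (int p))"
proof (cases "int p dvd t")
  case True
  then show ?thesis
    using prime_gt_0_nat[OF prime_p] by (simp add: cong_iff_dvd_diff dvd_power dvd_trans)
next
  case False
  then have "coprime t (int p)"
    using prime_imp_coprime[OF prime_int_p False] by (simp add: coprime_commute)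
  then have "[t ^ totient p = 1] (mod (int p))"
    by (rule euler_theorem_int)
  then have "[t * t ^ (p - 1) = t * 1] (mod (int p))"
    using prime_p by (intro cong_mult) (auto simp: totient_prime)
  then show ?thesis
    using prime_gt_0_nat[OF prime_p] by (cases p) auto
qed

section \<open>Recursion on the base p digits\<close>

text \<open>Fermat's theorem turns t^(p m) into t^m, and the denominators i and p m + i are units
  with the same residue, so it is enough to compare the cross-multiplied integers.\<close>

lemma pcong_unit_term:
  assumes "0 < i" "i < p"
  shows "pcong 1 (of_int t ^ (p * m + i) / of_nat (p * m + i)) (of_int t ^ m * (of_int t ^ i / of_nat i))"
proof -
  have i: "\<not> p dvd i" using assms by (rule not_dvd_if_less)
  then have pmi: "\<not> p dvd p * m + i" by (simp add: dvd_add_right_iff)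
  have nz: "of_nat i \<noteq> (0::rat)" "of_nat (p * m + i) \<noteq> (0::rat)"
    unfolding of_nat_eq_0_iff using assms(1) by simp_all
  have "[t ^ (p * m + i) * int i = t ^ m * t ^ i * int (p * m + i)] (mod (int p))"
  proof (rule cong_mult)
    show "[t ^ (p * m + i) = t ^ m * t ^ i] (mod (int p))"
      unfolding power_add power_mult by (intro cong_mult cong_pow fermat_int cong_refl)
    show "[int i = int (p * m + i)] (mod (int p))"
      by (simp add: cong_def)
  qed
  then have "pcong 1 (of_int t ^ (p * m + i) * of_nat i)
      (of_int t ^ m * of_int t ^ i * of_nat (p * m + i))"
    unfolding pcong_1_of_int_iff[symmetric] by simp
  then have "pcong 1 (of_int t ^ (p * m + i) * of_nat i / (of_nat i * of_nat (p * m + i)))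
      (of_int t ^ m * of_int t ^ i * of_nat (p * m + i) / (of_nat i * of_nat (p * m + i)))"
    using i pmi
    by (intro pcong_unit_divide)
      (simp_all add: padic_abs_mult padic_abs_of_nat_unit del: of_nat_add of_nat_mult)
  then show ?thesis using nz by (simp del: of_nat_add of_nat_mult)
qed

lemma pcong_unit_sum_add:
  assumes "b < p"
  shows "pcong 1 (unit_sum t (p * m + b)) (unit_sum t (p * m) + of_int t ^ m * trunc_log t b)"
  using assms
proof (induction b)
  case (Suc b)
  have "pcong 1 (unit_sum t (p * m + b) + of_int t ^ (p * m + Suc b) / of_nat (p * m + Suc b))
      (unit_sum t (p * m) + of_int t ^ m * trunc_log t b +
        of_int t ^ m * (of_int t ^ Suc b / of_nat (Suc b)))"
    using Suc by (intro pcong_add pcong_unit_term) auto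
  moreover have "\<not> p dvd Suc (p * m + b)"
    using not_dvd_if_less[of "Suc b"] Suc.prems dvd_add_right_iff[of p "p * m" "Suc b"] by simp
  then have "unit_sum t (p * m + Suc b) =
      unit_sum t (p * m + b) + of_int t ^ (p * m + Suc b) / of_nat (p * m + Suc b)"
    unfolding add_Suc_right unit_sum_Suc by simp
  ultimately show ?case
    unfolding trunc_log_Suc distrib_left by (simp only: add.assoc)
qed simp

lemma padic_abs_trunc_log_le_1: "m < p \<Longrightarrow> pabs (trunc_log t m) \<le> 1"
  using padic_abs_trunc_log_le[of m 0] by simp

text \<open>The indices form m complete blocks and one partial block; block number i is t^i times
  the initial block, modulo p.\<close>

lemma pcong_unit_sum:
  assumes "b < p"
  shows "pcong 1 (unit_sum t (p * m + b))
    ((\<Sum>i<m. of_int t ^ i) * trunc_log t (p - 1) + of_int t ^ m * trunc_log t b)"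
proof -
  have p: "p \<noteq> 0" using p_gt_1 by auto
  have "pcong 1 (unit_sum t (p * m)) ((\<Sum>i<m. of_int t ^ i) * trunc_log t (p - 1))"
  proof (induction m)
    case (Suc m)
    have "p * Suc m = Suc (p * m + (p - 1))" using p by simp
    moreover have "p dvd p * Suc m" by simp
    ultimately have "unit_sum t (p * Suc m) = unit_sum t (p * m + (p - 1))"
      by (simp only: unit_sum_Suc if_True add_0_right)
    also have "pcong 1 \<dots> (unit_sum t (p * m) + of_int t ^ m * trunc_log t (p - 1))"
      using p by (intro pcong_unit_sum_add) simp
    also have "pcong 1 \<dots> ((\<Sum>i<m. of_int t ^ i) * trunc_log t (p - 1) +
        of_int t ^ m * trunc_log t (p - 1))"
      by (intro pcong_add Suc pcong_refl)
    finally show ?case by (simp add: distrib_right)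
  qed simp
  then have "pcong 1 (unit_sum t (p * m) + of_int t ^ m * trunc_log t b)
    ((\<Sum>i<m. of_int t ^ i) * trunc_log t (p - 1) + of_int t ^ m * trunc_log t b)"
    by (intro pcong_add pcong_refl)
  with pcong_unit_sum_add[OF assms] show ?thesis by (rule pcong_trans)
qed

section \<open>Iterated p-th powers and Fermat quotients\<close>

lemma cong_iterated_fermat: "[t ^ p ^ r = t] (mod (int p))"
proof (induction r)
  case (Suc r)
  have "t ^ p ^ Suc r = (t ^ p ^ r) ^ p"
    by (simp add: mult.commute flip: power_mult)
  then show ?case
    using fermat_int[of "t ^ p ^ r"] Suc by (auto intro: cong_trans)
qed simp

text \<open>Euler's exponent for p^(s+1) is p^(s+1) - p^s, exactly the gap between consecutive
  exponents. The result lets one fixed residue replace the base no matter how far out the truncation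
  is: k = 1 serves two digits, k = 2 serves three.\<close>

lemma cong_two_power_p_power:
  assumes "odd p"
  shows "[2 ^ p ^ (k + r) = (2::int) ^ p ^ k] (mod (int p ^ Suc k))"
proof (induction r)
  case (Suc r)
  have "[2 ^ totient (p ^ Suc (k + r)) = (1::int)] (mod (int (p ^ Suc (k + r))))"
    using assms by (intro euler_theorem_int) simp
  then have "[2 ^ p ^ (k + r) * 2 ^ totient (p ^ Suc (k + r)) = 2 ^ p ^ (k + r) * (1::int)]
      (mod (int (p ^ Suc (k + r))))"
    by (rule cong_scalar_left)
  moreover have "p ^ (k + r) + totient (p ^ Suc (k + r)) = p ^ Suc (k + r)"
    unfolding totient_prime_power_Suc[OF prime_p] using p_gt_1 by (cases p) auto
  ultimately have "[2 ^ p ^ Suc (k + r) = (2::int) ^ p ^ (k + r)] (mod (int p ^ Suc (k + r)))"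
    by (simp only: power_add[symmetric] mult_1_right of_nat_power)
  then have "[2 ^ p ^ (k + Suc r) = (2::int) ^ p ^ (k + r)] (mod (int p ^ Suc k))"
    unfolding add_Suc_right by (rule cong_dvd_modulus) (simp add: le_imp_power_dvd)
  then show ?case using Suc by (rule cong_trans)
qed simp

text \<open>Pascal's rule and divisibility of \<open>p choose Suc j\<close> by p make neighbouring
  entries of row p - 1 negatives of each other.\<close>

lemma prime_choose_pred_cong:
  assumes "j < p"
  shows "[int ((p - 1) choose j) = (-1) ^ j] (mod (int p))"
  using assms
proof (induction j)
  case (Suc j)
  have p: "p = Suc (p - 1)" using Suc.prems by simp
  have "p dvd p choose Suc j"
    using dvd_choose_prime[of "Suc j" p] Suc.prems prime_p by simp
  then have "p dvd ((p - 1) choose j) + ((p - 1) choose Suc j)"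
    by (subst (asm) (2) p) simp
  then have "[int ((p - 1) choose Suc j) + int ((p - 1) choose j) = 0] (mod (int p))"
    by (auto simp: cong_0_iff add.commute simp flip: of_nat_add)
  then have "[int ((p - 1) choose Suc j) + int ((p - 1) choose j) - int ((p - 1) choose j) =
      0 - (-1) ^ j] (mod (int p))"
    using Suc by (intro cong_diff) auto
  then show ?case by simp
qed simp

text \<open>The Fermat quotient of \<open>2\<close>, read off from the binomial expansion of \<open>(1 - 2) ^ p\<close>.\<close>

lemma pcong_trunc_log_2_pred:
  assumes "odd p"
  shows "pcong 2 (of_nat p * trunc_log 2 (p - 1)) (2 - 2 ^ p)"
proof -
  define g where "g i = (of_nat (p choose i) * (-2) ^ i :: rat)" for i
  have p: "1 < p" using p_gt_1 by simp
  have split: "{..p} = insert 0 (insert p {1..p - 1})" using p by auto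
  have "(-2 + 1 :: rat) ^ p = (\<Sum>i\<le>p. g i)"
    unfolding binomial_ring g_def by simp
  then have "-1 = 1 + (- (2 ^ p) + (\<Sum>i = 1..p - 1. g i))"
    unfolding split using p assms by (simp add: g_def)
  then have sum_g: "(\<Sum>i = 1..p - 1. g i) = - (2 - 2 ^ p)"
    by simp
  have "pcong 2 (\<Sum>i = 1..p - 1. g i) (\<Sum>i = 1..p - 1. - (of_nat p * (2 ^ i / of_nat i)))"
  proof (rule pcong_sum)
    fix i assume i: "i \<in> {1..p - 1}"
    then obtain j where j: "i = Suc j" by (cases i) auto
    have jp: "j < p" using i j by simp
    have i_unit: "pabs (of_nat i) = 1"
      using i p by (intro padic_abs_of_nat_unit not_dvd_if_less) auto
    \<comment> \<open>Absorption extracts the factor p, so a congruence modulo p for the remaining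
      binomial coefficient gives one modulo p^2 for the term.\<close>
    have "i * (p choose i) = p * ((p - 1) choose j)"
      using Suc_times_binomial_eq[of "p - 1" j] p j by (simp add: mult.commute)
    then have "of_nat i * of_nat (p choose i) = (of_nat p * of_nat ((p - 1) choose j) :: rat)"
      by (simp only: of_nat_mult[symmetric])
    then have "of_nat (p choose i) = (of_nat p * of_nat ((p - 1) choose j) / of_nat i :: rat)"
      using i by (simp add: field_simps)
    then have g: "g i = of_nat p * (of_nat ((p - 1) choose j) * (-2) ^ i / of_nat i)"
      by (simp add: g_def)
    have "pcong 1 (of_int (int ((p - 1) choose j) * (-2) ^ i)) (of_int ((-1) ^ j * (-2) ^ i))"
      unfolding pcong_1_of_int_iff using prime_choose_pred_cong[OF jp] by (rule cong_scalar_right)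
    moreover have "(-1) ^ j * (-2) ^ i = - (2 ^ i :: int)"
    proof -
      have "(-1) ^ j * (-2) ^ j = (2 ^ j :: int)"
        by (subst power_mult_distrib[symmetric]) simp
      then show ?thesis by (simp add: j)
    qed
    ultimately have "pcong 1 (of_nat ((p - 1) choose j) * (-2) ^ i) (- (2 ^ i))"
      by simp
    then have "pcong 1 (of_nat ((p - 1) choose j) * (-2) ^ i / of_nat i) (- (2 ^ i) / of_nat i)"
      using i_unit by (rule pcong_unit_divide)
    then have "pcong 2 (g i) (of_nat p * (- (2 ^ i) / of_nat i))"
      unfolding g by (rule pcong_2_p_mult)
    then show "pcong 2 (g i) (- (of_nat p * (2 ^ i / of_nat i)))"
      by simp
  qed
  then have "pcong 2 (- (2 - 2 ^ p)) (- (of_nat p * trunc_log 2 (p - 1)))"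
    unfolding sum_g trunc_log_def by (simp add: sum_negf sum_distrib_left)
  then show ?thesis
    unfolding pcong_def by (simp add: algebra_simps)
qed

lemma add_power_cong_square:
  fixes a c :: int
  shows "[(a + c) ^ Suc j = a ^ Suc j + int (Suc j) * a ^ j * c] (mod c\<^sup>2)"
proof (induction j)
  case (Suc j)
  have "[(a + c) * (a + c) ^ Suc j = (a + c) * (a ^ Suc j + int (Suc j) * a ^ j * c)] (mod c\<^sup>2)"
    using Suc by (rule cong_scalar_left)
  moreover have "(a + c) * (a ^ Suc j + int (Suc j) * a ^ j * c) =
      a ^ Suc (Suc j) + int (Suc (Suc j)) * a ^ Suc j * c + c\<^sup>2 * (int (Suc j) * a ^ j)"
    by (simp add: algebra_simps power2_eq_square)
  ultimately show ?case
    by (simp add: cong_def)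
qed simp

text \<open>Put c = 2^p - 2, a multiple of p. To first order (2 + c)^j is 2^j + j 2^(j-1) c;
  division by j cancels the factor j, and the corrections form the geometric sum c (1 + 2 + ... +
  2^(d-1)).\<close>

lemma pcong_trunc_log_2_power_p:
  assumes "[t = 2 ^ p] (mod (int p)\<^sup>2)" "d < p"
  shows "pcong 2 (trunc_log t d) (trunc_log 2 d + (2 ^ p - 2) * (2 ^ d - 1))"
  using assms(2)
proof (induction d)
  case (Suc d)
  define c where "c = (2 ^ p - 2 :: int)"
  have d_unit: "pabs (of_nat (Suc d)) = 1"
    using Suc.prems by (intro padic_abs_of_nat_unit not_dvd_if_less) auto
  have "int p dvd c"
    using fermat_int[of 2] by (simp add: c_def cong_iff_dvd_diff)
  then have "(int p)\<^sup>2 dvd c\<^sup>2" by (rule dvd_power_same)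
  then have "[(2 + c) ^ Suc d = 2 ^ Suc d + int (Suc d) * 2 ^ d * c] (mod (int p)\<^sup>2)"
    using add_power_cong_square cong_dvd_modulus by blast
  then have "[t ^ Suc d = 2 ^ Suc d + int (Suc d) * 2 ^ d * c] (mod (int p)\<^sup>2)"
    using cong_pow[OF assms(1), of "Suc d"] by (auto simp: c_def intro: cong_trans)
  then have "pcong 2 (of_int t ^ Suc d) (2 ^ Suc d + of_nat (Suc d) * 2 ^ d * of_int c)"
    unfolding pcong_of_int_iff[symmetric] by simp
  then have "pcong 2 (of_int t ^ Suc d / of_nat (Suc d))
      ((2 ^ Suc d + of_nat (Suc d) * 2 ^ d * of_int c) / of_nat (Suc d))"
    using d_unit by (rule pcong_unit_divide)
  also have "(2 ^ Suc d + of_nat (Suc d) * 2 ^ d * of_int c) / of_nat (Suc d) =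
      (2 ^ Suc d / of_nat (Suc d) + 2 ^ d * of_int c :: rat)"
    by (simp add: add_divide_distrib del: of_nat_Suc power_Suc)
  finally have "pcong 2 (trunc_log t (Suc d))
      (trunc_log 2 d + (2 ^ p - 2) * (2 ^ d - 1) + (2 ^ Suc d / of_nat (Suc d) + 2 ^ d * of_int c))"
    unfolding trunc_log_Suc using Suc by (intro pcong_add) auto
  also have "trunc_log 2 d + (2 ^ p - 2) * (2 ^ d - 1) + (2 ^ Suc d / of_nat (Suc d) + 2 ^ d * of_int c) =
      trunc_log 2 (Suc d) + (2 ^ p - 2) * (2 ^ Suc d - 1)"
    by (simp add: trunc_log_Suc c_def algebra_simps del: of_nat_Suc)
  finally show ?case .
qed simp

text \<open>The first summand keeps its base because it is still divided by p: Fermat's theorem is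
  too coarse for replacing the base by 2. As m need not be a single digit, the formula serves two
  digits and three digits alike.\<close>

lemma pcong_scaled_trunc_log:
  assumes "M div p ^ r = p * m + b" "b < p"
  shows "pcong 1 (of_nat p ^ r * trunc_log 2 M)
    (trunc_log (2 ^ p ^ Suc r) m / of_nat p +
      ((2 ^ m - 1) * trunc_log 2 (p - 1) + 2 ^ m * trunc_log 2 b))"
proof -
  have p: "0 < p" using p_gt_1 by simp
  define t where "t = (2 ^ p ^ r :: int)"
  have t: "[t = 2] (mod (int p))" unfolding t_def by (rule cong_iterated_fermat)
  have T: "pcong 1 (trunc_log t i) (trunc_log 2 i)" if "i < p" for i
    using pcong_trunc_log_base[of t 2 1 0 i] t that by simp
  have P: "pcong 1 (of_int t ^ i) (2 ^ i)" for i
    using cong_pow[OF t, of i] unfolding pcong_1_of_int_iff[symmetric] by simp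
  have I: "pabs (2 ^ i) \<le> 1" for i
    using padic_abs_of_int_power_le_1[of 2 i] by simp
  have "t ^ p = 2 ^ p ^ Suc r"
    by (simp add: t_def mult.commute flip: power_mult)
  moreover have "(p * m + b) div p = m"
    using assms(2) p by simp
  ultimately have "trunc_log t (M div p ^ r) =
      trunc_log (2 ^ p ^ Suc r) m / of_nat p + unit_sum t (p * m + b)"
    unfolding assms(1) by (subst trunc_log_split) (simp del: power_Suc)
  moreover have "pcong 1 (unit_sum t (p * m + b))
      ((2 ^ m - 1) * trunc_log 2 (p - 1) + 2 ^ m * trunc_log 2 b)"
  proof -
    have "pcong 1 ((\<Sum>i<m. of_int t ^ i) * trunc_log t (p - 1) + of_int t ^ m * trunc_log t b)
        ((\<Sum>i<m. 2 ^ i) * trunc_log 2 (p - 1) + 2 ^ m * trunc_log 2 b)"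
      using assms(2) p
      by (intro pcong_add pcong_mult pcong_sum P T padic_abs_sum_le padic_abs_of_int_power_le_1)
        (auto intro: padic_abs_trunc_log_le_1)
    also have "(\<Sum>i<m. 2 ^ i) = (2 ^ m - 1 :: rat)"
      by (simp add: geometric_sum)
    finally show ?thesis
      using pcong_unit_sum[OF assms(2)] pcong_trans by blast
  qed
  ultimately have "pcong 1 (trunc_log t (M div p ^ r))
    (trunc_log (2 ^ p ^ Suc r) m / of_nat p +
      ((2 ^ m - 1) * trunc_log 2 (p - 1) + 2 ^ m * trunc_log 2 b))"
    by (simp only: pcong_add pcong_refl)
  with pcong_trunc_log_div show ?thesis
    unfolding t_def by (rule pcong_trans)
qed

text \<open>The Fermat quotients coming from \<open>2 ^ p\<close> and from the complete block \<open>trunc_log 2 (p - 1)\<close>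
  cancel.\<close>

lemma pcong_trunc_log_two_digits:
  assumes "odd p" "M div p ^ r = p * d + e" "d < p" "e < p"
  shows "pcong 1 (of_nat p ^ r * trunc_log 2 M) (trunc_log 2 d / of_nat p + 2 ^ d * trunc_log 2 e)"
proof -
  have p: "of_nat p \<noteq> (0::rat)" using p_gt_1 by simp
  let ?q = "(2 ^ p - 2) / of_nat p :: rat"
  have "[2 ^ p ^ Suc r = 2 ^ p] (mod (int p)\<^sup>2)"
    using cong_two_power_p_power[OF assms(1), of 1 r] by (simp add: numeral_2_eq_2)
  then have "pcong 2 (trunc_log (2 ^ p ^ Suc r) d) (trunc_log 2 d + (2 ^ p - 2) * (2 ^ d - 1))"
    using assms(3) by (rule pcong_trunc_log_2_power_p)
  then have 1: "pcong 1 (trunc_log (2 ^ p ^ Suc r) d / of_nat p)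
      (trunc_log 2 d / of_nat p + (2 ^ d - 1) * ?q)"
  proof (rule pcong_2_div_p[THEN pcong_trans])
    have "(trunc_log 2 d + (2 ^ p - 2) * (2 ^ d - 1)) / of_nat p =
        trunc_log 2 d / of_nat p + (2 ^ d - 1) * ?q"
      by (simp add: add_divide_distrib mult.commute)
    then show "pcong 1 ((trunc_log 2 d + (2 ^ p - 2) * (2 ^ d - 1)) / of_nat p)
        (trunc_log 2 d / of_nat p + (2 ^ d - 1) * ?q)"
      by (simp only: pcong_refl)
  qed
  have "pcong 1 (trunc_log 2 (p - 1)) (- ?q)"
    using pcong_2_div_p[OF pcong_trunc_log_2_pred[OF assms(1)]] p
    by (simp add: minus_divide_left)
  then have 2: "pcong 1 ((2 ^ d - 1) * trunc_log 2 (p - 1)) ((2 ^ d - 1) * - ?q)"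
    using padic_abs_of_int_le_1[of "2 ^ d - 1"] by (intro pcong_mult_left) auto
  have "pcong 1 (of_nat p ^ r * trunc_log 2 M)
      (trunc_log 2 d / of_nat p + (2 ^ d - 1) * ?q + ((2 ^ d - 1) * - ?q + 2 ^ d * trunc_log 2 e))"
    using pcong_scaled_trunc_log[OF assms(2,4)] pcong_add[OF 1 pcong_add[OF 2 pcong_refl]]
    by (rule pcong_trans)
  then show ?thesis by simp
qed

text \<open>For d < p all denominators are units, so here Fermat's theorem does suffice to return to
  the base 2.\<close>

lemma pcong_trunc_log_one_digit:
  assumes "M div p ^ r = d" "d < p"
  shows "pcong 1 (of_nat p ^ r * trunc_log 2 M) (trunc_log 2 d)"
proof -
  have "pcong 1 (trunc_log (2 ^ p ^ r) d) (trunc_log 2 d)"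
    using pcong_trunc_log_base[of "2 ^ p ^ r" 2 1 0 d] cong_iterated_fermat assms(2) by simp
  with pcong_trunc_log_div[of r 2 M] show ?thesis
    unfolding assms(1) by (rule pcong_trans)
qed

section \<open>Good primes\<close>

lemma padic_abs_2:
  assumes "odd p"
  shows "pabs 2 = 1"
proof -
  have "\<not> p dvd 2"
  proof
    assume "p dvd 2"
    then have "p \<le> 2" by (rule dvd_imp_le) simp
    then show False using assms p_gt_1 by (cases "p = 2") auto
  qed
  then show ?thesis using padic_abs_of_nat_unit[of 2] by simp
qed

lemma padic_abs_inv_binom_sum:
  assumes "odd p"
  shows "pabs (inv_binom_sum n) = pabs (of_nat (Suc n)) * pabs (trunc_log 2 (Suc n))"
  unfolding inv_binom_sum_eq_trunc_log
  using padic_abs_2[OF assms]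
  by (simp add: padic_abs_mult padic_abs_divide padic_abs_power del: of_nat_Suc power_Suc)

lemma inv_binom_sum_nonzero: "inv_binom_sum n \<noteq> 0"
proof -
  have "0 < inv_binom_sum n"
    unfolding inv_binom_sum_def by (rule sum_pos) auto
  then show ?thesis by simp
qed

text \<open>For d < p both d and 2 are units, so \<open>trunc_log 2 d\<close> has the absolute value
  of \<open>inv_binom_sum (d - 1)\<close>. Goodness starts at index 1 and leaves out d = 1, where
  the sum is the unit 2.\<close>

lemma good_prime_padic_abs_ge:
  assumes "good_prime p" "odd p" "0 < d" "d < p"
  shows "1 / real p \<le> pabs (trunc_log 2 d)"
proof (cases "d = 1")
  case True
  then show ?thesis
    using padic_abs_2[OF assms(2)] p_gt_1 by (simp add: trunc_log_def)
next
  case False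
  then obtain n where n: "d = Suc n" "n \<in> {1..p - 2}"
    using assms by (cases d) auto
  have "1 / real p = real p powi (-1)"
    using p_gt_1 by (simp add: power_int_minus field_simps)
  also have "\<dots> \<le> real p powi (- padic_val p (inv_binom_sum n))"
    using assms(1) n p_gt_1 by (intro power_int_increasing) (auto simp: good_prime_def)
  also have "\<dots> = pabs (inv_binom_sum n)"
    by (simp add: padic_abs_def inv_binom_sum_nonzero)
  also have "\<dots> = pabs (trunc_log 2 d)"
    using padic_abs_inv_binom_sum[OF assms(2), of n] assms(3,4) n
    by (simp add: padic_abs_of_nat_unit not_dvd_if_less del: of_nat_Suc)
  finally show ?thesis .
qed

lemma padic_abs_scaled_iff: "1 \<le> pabs (of_nat p ^ r * x) \<longleftrightarrow> real p ^ r \<le> pabs x"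
  using p_gt_1 by (simp add: padic_abs_mult padic_abs_power field_simps)

lemma padic_abs_ge_1_if_pcong:
  assumes "pcong 1 x y" "1 \<le> pabs y"
  shows "1 \<le> pabs x"
proof -
  have "1 / real p < 1" using p_gt_1 by simp
  also note assms(2)
  finally show ?thesis
    using pcong_abs_eq[OF pcong_sym[OF assms(1)]] assms(2) by simp
qed

lemma large_if_leading_digit:
  assumes "M div p ^ r = d" "d < p" "1 \<le> pabs (trunc_log 2 d)"
  shows "real p ^ r \<le> pabs (trunc_log 2 M)"
  using padic_abs_ge_1_if_pcong[OF pcong_trunc_log_one_digit[OF assms(1,2)] assms(3)]
  by (simp add: padic_abs_scaled_iff)

lemma large_if_good:
  assumes "good_prime p" "odd p"
    and "M div p ^ r = p * d + e" "M' div p ^ r = e" "0 < d" "d < p" "e < p"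
  shows "real p ^ r \<le> pabs (trunc_log 2 M) \<or> real p ^ r \<le> pabs (trunc_log 2 M')"
proof (cases "1 \<le> pabs (trunc_log 2 e)")
  case True
  then show ?thesis using large_if_leading_digit[OF assms(4,7)] by simp
next
  \<comment> \<open>The digit e = 0 falls under this case, its sum being 0. Goodness makes the first
    summand at least 1 in absolute value whether or not p divides \<open>trunc_log 2 d\<close>, and
    the second summand is smaller.\<close>
  case False
  then have e: "pabs (trunc_log 2 e) < 1" by simp
  have "pcong 1 (of_nat p ^ r * trunc_log 2 M) (trunc_log 2 d / of_nat p + 2 ^ d * trunc_log 2 e)"
    by (rule pcong_trunc_log_two_digits) fact+
  moreover have "1 \<le> pabs (trunc_log 2 d / of_nat p + 2 ^ d * trunc_log 2 e)"
  proof -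
    have 1: "1 \<le> pabs (trunc_log 2 d / of_nat p)"
      using good_prime_padic_abs_ge[OF assms(1,2,5,6)] p_gt_1
      by (simp add: padic_abs_divide field_simps)
    have "pabs (- (2 ^ d * trunc_log 2 e)) < 1"
      using e by (simp add: padic_abs_mult padic_abs_power padic_abs_2[OF assms(2)])
    then have "pabs (trunc_log 2 d / of_nat p - (trunc_log 2 d / of_nat p + 2 ^ d * trunc_log 2 e)) <
        pabs (trunc_log 2 d / of_nat p)"
      using 1 by simp
    from padic_abs_eq_if_close[OF this] 1 show ?thesis by simp
  qed
  ultimately have "1 \<le> pabs (of_nat p ^ r * trunc_log 2 M)"
    by (rule padic_abs_ge_1_if_pcong)
  then show ?thesis by (simp add: padic_abs_scaled_iff)
qed

end

section \<open>The prime 23\<close>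

text \<open>Entry \<open>b\<close> is the residue of \<open>trunc_log 2 b\<close> modulo \<open>23\<close>.\<close>

definition trunc_log_table :: "int list" where
  "trunc_log_table = [0, 2, 4, 22, 3, 14, 17, 9, 18, 11, 3, 1, 5, 0, 17, 15, 17, 14, 16, 21, 19, 13, 12]"

text \<open>The recurrence of \<open>trunc_log 2\<close> with its denominator cleared, so that the
  table is verified in integer arithmetic.\<close>

lemma trunc_log_table_step:
  assumes "b < 22"
  shows "[int (Suc b) * (trunc_log_table ! Suc b - trunc_log_table ! b) = 2 ^ Suc b] (mod 23)"
proof -
  have "list_all (\<lambda>b. int (Suc b) * (trunc_log_table ! Suc b - trunc_log_table ! b) mod 23 =
      2 ^ Suc b mod 23) [0..<22]"
    by code_simp
  then show ?thesis using assms by (simp add: list_all_iff cong_def)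
qed

lemma trunc_log_table_nonzero:
  assumes "0 < d" "d < 23" "d \<noteq> 13"
  shows "trunc_log_table ! d mod 23 \<noteq> 0"
proof -
  have "list_all (\<lambda>d. d = 13 \<or> trunc_log_table ! d mod 23 \<noteq> 0) [1..<23]"
    by code_simp
  then have "\<forall>d\<in>{1..<23}. d = 13 \<or> trunc_log_table ! d mod 23 \<noteq> 0"
    by (simp only: list_all_iff set_upt)
  moreover have "d \<in> {1..<23}"
    using assms(1,2) by simp
  ultimately have "d = 13 \<or> trunc_log_table ! d mod 23 \<noteq> 0"
    by (rule bspec)
  then show ?thesis using assms(3) by simp
qed

text \<open>After \<open>j\<close> steps \<open>N / D\<close> is \<open>23 * trunc_log t j\<close> and \<open>T\<close> is \<open>t ^ j\<close>, both modulo
  \<open>12167 = 23 ^ 3\<close>, for any \<open>t\<close> congruent to \<open>11364 = 2 ^ 529 mod 12167\<close>. For \<open>j = 23 * 13 + a\<close> the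
  check says that \<open>p ^ r * trunc_log 2 M\<close> is nonzero modulo \<open>23\<close> if \<open>M div p ^ r\<close> has
  the digits \<open>13\<close>, \<open>a\<close>, \<open>b\<close>; here \<open>P\<close> is \<open>2 ^ j\<close> modulo \<open>23\<close>.\<close>

fun acc_step :: "int \<Rightarrow> int \<times> int \<times> int \<Rightarrow> int \<times> int \<times> int" where
  "acc_step j (N, D, T) = (let T' = T * 11364 mod 12167 in
     if j mod 23 = 0 then (let i = j div 23 in ((N * i + T' * D) mod 12167, D * i mod 12167, T'))
     else ((N * j + 23 * T' * D) mod 12167, D * j mod 12167, T'))"

fun acc_check :: "int \<Rightarrow> int \<times> int \<times> int \<Rightarrow> bool" where
  "acc_check P (N, D, T) = list_all
     (\<lambda>s. (N + 529 * D * ((P - 1) * (trunc_log_table ! 22) + P * s)) mod 12167 \<noteq> 0)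
     trunc_log_table"

fun acc_run :: "int list \<Rightarrow> int \<Rightarrow> int \<times> int \<times> int \<Rightarrow> bool" where
  "acc_run [] P st = True"
| "acc_run (j # js) P st = (let P' = 2 * P mod 23; st' = acc_step j st in
     (j < 299 \<or> acc_check P' st') \<and> acc_run js P' st')"

text \<open>The indices 299 to 321 are 23 * 13 + a for the 23 digits a. The initial state encodes
  the empty sum as 0/1 together with t^0, and the initial P is 2^0.\<close>

lemma acc_run_true: "acc_run [1..321] 1 (0, 1, 1)"
  by code_simp

section \<open>Soundness of the computation modulo 23^3\<close>

context prime_base
begin

context
  assumes p23: "p = 23"
begin

lemma padic_abs_p_mult_trunc_log: "m < 529 \<Longrightarrow> pabs (of_nat p * trunc_log t m) \<le> 1"
proof -
  assume "m < 529"
  then have "m < p ^ Suc 1" by (simp add: p23)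
  then have "pabs (trunc_log t m) \<le> real p"
    using padic_abs_trunc_log_le[of m 1 t] by simp
  then show ?thesis using p_gt_1 by (simp add: padic_abs_mult field_simps)
qed

lemma pcong_3_of_int: "pcong 3 (of_int a) (of_int b) \<longleftrightarrow> [a = b] (mod 12167)"
  using pcong_of_int_iff[of 3 a b] by (simp add: p23)

lemma pcong_trunc_log_table: "b < 23 \<Longrightarrow> pcong 1 (trunc_log 2 b) (of_int (trunc_log_table ! b))"
proof (induction b)
  case 0
  then show ?case by (simp add: trunc_log_table_def)
next
  case (Suc b)
  have u: "pabs (of_nat (Suc b)) = 1"
    using Suc.prems by (intro padic_abs_of_nat_unit not_dvd_if_less) (auto simp: p23)
  have "[int (Suc b) * (trunc_log_table ! Suc b - trunc_log_table ! b) = 2 ^ Suc b] (mod (int p))"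
    using trunc_log_table_step[of b] Suc.prems unfolding p23 by simp
  then have "pcong 1 (of_nat (Suc b) * (of_int (trunc_log_table ! Suc b) - of_int (trunc_log_table ! b)))
      (2 ^ Suc b)"
    unfolding pcong_1_of_int_iff[symmetric] by simp
  then have "pcong 1
      (of_nat (Suc b) * (of_int (trunc_log_table ! Suc b) - of_int (trunc_log_table ! b)) / of_nat (Suc b))
      (2 ^ Suc b / of_nat (Suc b))"
    using u by (rule pcong_unit_divide)
  then have "pcong 1 (2 ^ Suc b / of_nat (Suc b))
      (of_int (trunc_log_table ! Suc b) - of_int (trunc_log_table ! b))"
    by (subst (asm) nonzero_mult_div_cancel_left) (auto intro: pcong_sym simp del: of_nat_Suc power_Suc)
  then have "pcong 1 (trunc_log 2 b + 2 ^ Suc b / of_nat (Suc b))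
      (of_int (trunc_log_table ! b) + (of_int (trunc_log_table ! Suc b) - of_int (trunc_log_table ! b)))"
    using Suc by (intro pcong_add) auto
  then show ?case
    by (simp add: trunc_log_Suc del: of_nat_Suc power_Suc)
qed

text \<open>The fraction N / D stays cross-multiplied, which avoids modular inverses; D remains a
  unit at 23. The factor p makes the sum 23-integral for indices below 23^2.\<close>

definition acc_inv :: "int \<Rightarrow> nat \<Rightarrow> int \<times> int \<times> int \<Rightarrow> bool" where
  "acc_inv t m = (\<lambda>(N, D, T). \<not> 23 dvd D \<and> [T = t ^ m] (mod 12167) \<and>
    pcong 3 (of_int D * (of_nat p * trunc_log t m)) (of_int N))"

lemma acc_inv_step:
  assumes t: "[t = 11364] (mod 12167)" and "m < 528" and inv: "acc_inv t m st"
  shows "acc_inv t (Suc m) (acc_step (int (Suc m)) st)"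
proof -
  obtain N D T where st: "st = (N, D, T)" by (cases st)
  define j where "j = int (Suc m)"
  define T' where "T' = T * 11364 mod 12167"
  have D: "\<not> 23 dvd D" and T: "[T = t ^ m] (mod 12167)"
    and N: "pcong 3 (of_int D * (of_nat p * trunc_log t m)) (of_int N)"
    using inv by (auto simp: st acc_inv_def)
  have T': "[T' = t ^ Suc m] (mod 12167)"
    using cong_mult[OF T t] by (auto simp: T'_def mult.commute intro: cong_trans cong_sym)
      (metis T'_def cong_mod_left cong_mult cong_sym mult.commute t T)
  have "pcong 3 (of_int (t ^ Suc m)) (of_int T')"
    unfolding pcong_3_of_int using T' by (rule cong_sym)
  then have P: "pcong 3 (of_int t ^ Suc m) (of_int T')" by simp
  have p23': "prime (23::int)" by simp
  \<comment> \<open>Both branches of \<open>acc_step\<close> add c T' / i, where p / (m + 1) = c /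
    i: the pair (c, i) is (1, j / 23) or (23, j), and i is prime to 23.\<close>
  have step: "acc_inv t (Suc m) (N' mod 12167, D * i mod 12167, T')"
    if i: "\<not> 23 dvd i" and N': "N' = N * i + c * (T' * D)"
      and c: "of_nat p / of_nat (Suc m) = (of_int c / of_int i :: rat)" for N' i c
  proof -
    have i0: "i \<noteq> 0" using i by auto
    have "of_int (D * i) * (of_nat p * trunc_log t (Suc m)) =
        of_int i * (of_int D * (of_nat p * trunc_log t m)) +
        of_int (D * i) * (of_int t ^ Suc m * (of_nat p / of_nat (Suc m)))"
      by (simp add: trunc_log_Suc algebra_simps del: of_nat_Suc power_Suc)
    also have "\<dots> = of_int i * (of_int D * (of_nat p * trunc_log t m)) +
        of_int (c * D) * of_int t ^ Suc m"
      unfolding c using i0 by (simp del: power_Suc)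
    also have "pcong 3 \<dots> (of_int i * of_int N + of_int (c * D) * of_int T')"
      by (intro pcong_add pcong_mult_left N P padic_abs_of_int_le_1)
    also have "of_int i * of_int N + of_int (c * D) * of_int T' = (of_int N' :: rat)"
      by (simp add: N')
    finally have 1: "pcong 3 (of_int (D * i) * (of_nat p * trunc_log t (Suc m))) (of_int N')" .
    have "pcong 3 (of_int (D * i mod 12167)) (of_int (D * i))"
      unfolding pcong_3_of_int by simp
    \<comment> \<open>Reducing D * i is legitimate because the other factor is 23-integral.\<close>
    then have "pcong 3 ((of_nat p * trunc_log t (Suc m)) * of_int (D * i mod 12167))
        ((of_nat p * trunc_log t (Suc m)) * of_int (D * i))"
      by (rule pcong_mult_left)
        (use assms(2) in \<open>simp add: padic_abs_p_mult_trunc_log del: of_nat_Suc\<close>)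
    then have 2: "pcong 3 (of_int (D * i mod 12167) * (of_nat p * trunc_log t (Suc m)))
        (of_int (D * i) * (of_nat p * trunc_log t (Suc m)))"
      by (simp only: mult.commute)
    have 3: "pcong 3 (of_int N') (of_int (N' mod 12167))"
      unfolding pcong_3_of_int by simp
    have "\<not> 23 dvd D * i" using D i prime_dvd_mult_iff[OF p23'] by blast
    then have "\<not> 23 dvd D * i mod 12167" by (simp add: dvd_mod_iff)
    then show ?thesis
      using T' pcong_trans[OF pcong_trans[OF 2 1] 3] by (simp add: acc_inv_def)
  qed
  show ?thesis
  proof (cases "j mod 23 = 0")
    case True
    define i where "i = j div 23"
    have ji: "j = 23 * i" using True unfolding i_def by presburger
    then have "0 < i" "i < 23" using assms(2) by (auto simp: j_def)
    then have "\<not> 23 dvd i" by (auto dest: zdvd_imp_le)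
    moreover have "of_nat (Suc m) = (23 * of_int i :: rat)"
      using arg_cong[OF ji, of of_int] by (simp add: j_def)
    then have "of_nat p / of_nat (Suc m) = (of_int 1 / of_int i :: rat)"
      using \<open>0 < i\<close> by (simp add: p23 del: of_nat_Suc)
    ultimately show ?thesis
      using step[of i _ 1] True unfolding j_def[symmetric] st by (simp add: Let_def T'_def i_def)
  next
    case False
    then have "\<not> 23 dvd j" by (simp add: dvd_eq_mod_eq_0)
    moreover have "of_nat p / of_nat (Suc m) = (of_int 23 / of_int j :: rat)"
      by (simp add: p23 j_def)
    ultimately show ?thesis
      using step[of j _ 23] False unfolding j_def[symmetric] st by (simp add: Let_def T'_def mult.assoc)
  qed
qed

text \<open>The whole run is evaluated once; induction along its list carries the invariant to the
  wanted index and extracts the check there. For P the residue modulo 23 is enough, since it enters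
  only with the factor 529.\<close>

lemma acc_run_sound:
  assumes t: "[t = 11364] (mod 12167)" and m': "299 \<le> m'" "m' \<le> 321"
  shows "acc_run [int (Suc m)..321] P st \<Longrightarrow> m < m' \<Longrightarrow> acc_inv t m st \<Longrightarrow> [P = 2 ^ m] (mod 23) \<Longrightarrow>
    \<exists>P' st'. acc_check P' st' \<and> acc_inv t m' st' \<and> [P' = 2 ^ m'] (mod 23)"
proof (induction "m' - m" arbitrary: m P st)
  case (Suc k)
  define st' where "st' = acc_step (int (Suc m)) st"
  define P' where "P' = 2 * P mod 23"
  have le: "int (Suc m) \<le> 321" using Suc.prems(2) m' by simp
  have run: "int (Suc m) < 299 \<or> acc_check P' st'" "acc_run [int (Suc (Suc m))..321] P' st'"
    using Suc.prems(1) unfolding upto_rec1[OF le]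
    by (simp_all add: Let_def st'_def P'_def add.commute)
  have inv: "acc_inv t (Suc m) st'"
    unfolding st'_def using Suc.prems(2,3) m' by (intro acc_inv_step t) auto
  have P': "[P' = 2 ^ Suc m] (mod 23)"
    using cong_scalar_left[OF Suc.prems(4), of 2] by (simp add: P'_def cong_def)
  show ?case
  proof (cases "Suc m = m'")
    case True
    then have "acc_check P' st'" using run(1) m' by auto
    then show ?thesis using inv P' True by blast
  next
    case False
    then show ?thesis
      using Suc.hyps(1)[of "Suc m", OF _ run(2) _ inv P'] Suc.hyps(2) Suc.prems(2) by simp
  qed
qed simp

text \<open>The scaled sum X can have 23^2 in its denominator, so p^2 X is shown to be nonzero
  modulo p^3, which forces X to have absolute value at least 1. The positive exponent
  \<open>Suc r\<close> ensures that the base 2^(p^(r+2)) agrees with 2^(p^2) modulo p^3.\<close>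

lemma large_23:
  assumes M: "M div p ^ Suc r = p * (p * 13 + a) + b" and ab: "a < p" "b < p"
  shows "real p ^ Suc r \<le> pabs (trunc_log 2 M)"
proof -
  define t where "t = (2 ^ p ^ Suc (Suc r) :: int)"
  define m where "m = p * 13 + a"
  define X where "X = of_nat p ^ Suc r * trunc_log 2 M"
  have "odd p" by (simp add: p23)
  then have "[2 ^ p ^ (2 + r) = (2::int) ^ p ^ 2] (mod (int p ^ Suc 2))"
    by (rule cong_two_power_p_power)
  then have "[t = 2 ^ p ^ 2] (mod (int p ^ Suc 2))"
    by (simp only: t_def add_2_eq_Suc)
  then have "[t = 2 ^ 529] (mod 12167)" by (simp add: p23)
  then have t: "[t = 11364] (mod 12167)" by (simp add: cong_def)
  have m: "299 \<le> m" "m \<le> 321" using ab by (auto simp: m_def p23)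
  have "acc_inv t 0 (0, 1, 1)" unfolding acc_inv_def by simp
  then obtain P N D T where chk: "acc_check P (N, D, T)" and inv: "acc_inv t m (N, D, T)"
    and P: "[P = 2 ^ m] (mod 23)"
    using acc_run_sound[OF t m, of 0 1 "(0, 1, 1)"] acc_run_true m by auto
  define B where "B = (P - 1) * trunc_log_table ! 22 + P * trunc_log_table ! b"
  have Q: "pcong 1 (2 ^ m) (of_int P)"
    using cong_sym[OF P] pcong_1_of_int_iff[of "2 ^ m" P] by (simp add: p23)
  have "pcong 1 ((2 ^ m - 1) * trunc_log 2 22 + 2 ^ m * trunc_log 2 b)
      ((of_int P - 1) * of_int (trunc_log_table ! 22) + of_int P * of_int (trunc_log_table ! b))"
    using ab p23 padic_abs_of_int_power_le_1[of 2 m] padic_abs_of_int_le_1[of "2 ^ m - 1"]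
    by (intro pcong_add pcong_mult pcong_diff Q pcong_refl pcong_trunc_log_table padic_abs_of_int_le_1)
      simp_all
  then have B: "pcong 1 ((2 ^ m - 1) * trunc_log 2 22 + 2 ^ m * trunc_log 2 b) (of_int B)"
    by (simp add: B_def)
  have "pcong 1 X (trunc_log t m / of_nat p + ((2 ^ m - 1) * trunc_log 2 (p - 1) + 2 ^ m * trunc_log 2 b))"
    unfolding X_def t_def using M ab(2) unfolding m_def[symmetric] by (rule pcong_scaled_trunc_log)
  also have "pcong 1 \<dots> (trunc_log t m / of_nat p + of_int B)"
    using B by (intro pcong_add pcong_refl) (simp add: p23)
  finally have "pcong 2 (of_nat p * X) (of_nat p * (trunc_log t m / of_nat p + of_int B))"
    by (rule pcong_2_p_mult)
  then have "pcong 3 (of_nat p * (of_nat p * X))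
      (of_nat p * (of_nat p * (trunc_log t m / of_nat p + of_int B)))"
    using pcong_p_mult_iff[of 2] by (simp add: numeral_3_eq_3 numeral_2_eq_2)
  then have "pcong 3 (of_int D * (of_nat p * (of_nat p * X)))
      (of_int D * (of_nat p * (of_nat p * (trunc_log t m / of_nat p + of_int B))))"
    by (rule pcong_mult_left) (rule padic_abs_of_int_le_1)
  also have "of_int D * (of_nat p * (of_nat p * (trunc_log t m / of_nat p + of_int B))) =
      of_int D * (of_nat p * trunc_log t m) + of_int (529 * D * B)"
  proof -
    have "of_nat p * (of_nat p * (h / of_nat p + c)) = of_nat p * h + 529 * c" for h c :: rat
      by (simp add: p23)
    then show ?thesis by (simp only: distrib_left of_int_mult of_int_numeral mult.left_commute)
  qed
  also have "pcong 3 \<dots> (of_int N + of_int (529 * D * B))"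
    using inv unfolding acc_inv_def by (intro pcong_add pcong_refl) auto
  finally have fin: "pcong 3 (of_int D * (of_nat p * (of_nat p * X))) (of_int (N + 529 * D * B))"
    by simp
  have "trunc_log_table ! b \<in> set trunc_log_table"
    using ab by (intro nth_mem) (simp add: trunc_log_table_def p23)
  then have "(N + 529 * D * B) mod 12167 \<noteq> 0"
    using chk by (auto simp: list_all_iff B_def)
  then have "\<not> int p ^ 3 dvd N + 529 * D * B"
    by (simp add: p23 dvd_eq_mod_eq_0)
  then have "1 / real p ^ 3 < pabs (of_int (N + 529 * D * B))"
    unfolding padic_abs_of_int_le_iff[symmetric] by simp
  then have "1 / real p ^ 3 < pabs (of_int D * (of_nat p * (of_nat p * X)))"
    using pcong_abs_eq[OF pcong_sym[OF fin]] by simp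
  also have "\<dots> = pabs X / real p ^ 2"
  proof -
    have "\<not> int p dvd D" using inv unfolding acc_inv_def by (simp add: p23)
    then have "pabs (of_int D) = 1" by (rule padic_abs_of_int_unit)
    then show ?thesis by (simp add: padic_abs_mult power2_eq_square)
  qed
  finally have "1 / real p < pabs X"
    using p_gt_1 by (simp add: field_simps power2_eq_square power3_eq_cube)
  then have "1 \<le> pabs X"
    using padic_abs_less_1_imp_le[of X] by linarith
  then show ?thesis
    unfolding X_def padic_abs_scaled_iff .
qed

lemma trunc_log_23_unit:
  assumes "0 < d" "d < p" "d \<noteq> 13"
  shows "1 \<le> pabs (trunc_log 2 d)"
proof -
  have "trunc_log_table ! d mod 23 \<noteq> 0"
    using assms unfolding p23 by (intro trunc_log_table_nonzero)
  then have "\<not> int p dvd trunc_log_table ! d"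
    by (simp add: p23 dvd_eq_mod_eq_0)
  then have "1 \<le> pabs (of_int (trunc_log_table ! d))"
    by (simp add: padic_abs_of_int_unit)
  moreover have "pcong 1 (trunc_log 2 d) (of_int (trunc_log_table ! d))"
    using assms(2) p23 by (intro pcong_trunc_log_table) simp
  ultimately show ?thesis by (rule padic_abs_ge_1_if_pcong[rotated])
qed

end

section \<open>Completion and digit expansions\<close>

lemma padic_abs_triangle_add: "pabs (x - z) \<le> pabs (x - y) + pabs (y - z)"
proof -
  have "max (pabs (x - y)) (pabs (y - z)) \<le> pabs (x - y) + pabs (y - z)" by simp
  with padic_abs_triangle[of x z y] show ?thesis by linarith
qed

lemma padic_abs_diff_abs: "\<bar>pabs x - pabs y\<bar> \<le> pabs (x - y)"
  using padic_abs_triangle_add[of x 0 y] padic_abs_triangle_add[of y 0 x]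
    padic_abs_minus_commute[of x y] by simp

lemma padic_CauchyD:
  assumes "padic_Cauchy p u" "0 < e"
  obtains N where "\<And>m n. m \<ge> N \<Longrightarrow> n \<ge> N \<Longrightarrow> pabs (u m - u n) < e"
  using assms unfolding padic_Cauchy_def by blast

lemma padic_Cauchy_const: "padic_Cauchy p (\<lambda>_. q)"
  by (simp add: padic_Cauchy_def)

lemma padic_Cauchy_convergent:
  assumes "padic_Cauchy p u" "padic_Cauchy p v"
  shows "convergent (\<lambda>n. pabs (u n - v n))"
proof -
  have "Cauchy (\<lambda>n. pabs (u n - v n))"
  proof (rule metric_CauchyI)
    fix e :: real assume e: "0 < e"
    then have e2: "0 < e / 2" by simp
    obtain N where N: "\<And>m n. m \<ge> N \<Longrightarrow> n \<ge> N \<Longrightarrow> pabs (u m - u n) < e / 2"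
      using padic_CauchyD[OF assms(1) e2] by blast
    obtain K where K: "\<And>m n. m \<ge> K \<Longrightarrow> n \<ge> K \<Longrightarrow> pabs (v m - v n) < e / 2"
      using padic_CauchyD[OF assms(2) e2] by blast
    show "\<exists>M. \<forall>m\<ge>M. \<forall>n\<ge>M. dist (pabs (u m - v m)) (pabs (u n - v n)) < e"
    proof (intro exI allI impI)
      fix m n assume mn: "max N K \<le> m" "max N K \<le> n"
      have "\<bar>pabs (u m - v m) - pabs (u n - v n)\<bar> \<le> pabs ((u m - v m) - (u n - v n))"
        by (rule padic_abs_diff_abs)
      also have "\<dots> = pabs ((u m - u n) - (v m - v n))"
        by (simp add: algebra_simps)
      also have "\<dots> \<le> max (pabs (u m - u n)) (pabs (v m - v n))"
        by (rule padic_abs_diff)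
      also have "\<dots> < e" using N[of m n] K[of m n] mn e by simp
      finally show "dist (pabs (u m - v m)) (pabs (u n - v n)) < e"
        by (simp add: dist_real_def)
    qed
  qed
  then show ?thesis by (simp add: Cauchy_convergent_iff)
qed

lemma padic_rel_iff:
  "(u, v) \<in> padic_rel p \<longleftrightarrow> padic_Cauchy p u \<and> padic_Cauchy p v \<and>
    (\<lambda>n. pabs (u n - v n)) \<longlonglongrightarrow> 0"
  by (simp add: padic_rel_def)

lemma equiv_padic_rel: "equiv {u. padic_Cauchy p u} (padic_rel p)"
proof (rule equivI)
  show "sym (padic_rel p)"
    by (rule symI) (simp add: padic_rel_iff padic_abs_minus_commute)
  show "trans (padic_rel p)"
  proof (rule transI)
    fix u v w assume "(u, v) \<in> padic_rel p" "(v, w) \<in> padic_rel p"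
    then have uv: "(\<lambda>n. pabs (u n - v n)) \<longlonglongrightarrow> 0" and vw: "(\<lambda>n. pabs (v n - w n)) \<longlonglongrightarrow> 0"
      and C: "padic_Cauchy p u" "padic_Cauchy p w"
      by (auto simp: padic_rel_iff)
    have "(\<lambda>n. pabs (u n - w n)) \<longlonglongrightarrow> 0"
      by (rule tendsto_sandwich[OF _ _ tendsto_const tendsto_add_zero[OF uv vw]])
        (auto simp: padic_abs_triangle_add)
    then show "(u, w) \<in> padic_rel p" using C by (simp add: padic_rel_iff)
  qed
qed (auto simp: refl_on_def padic_rel_iff)

lemma padic_field_rel:
  assumes "X \<in> padic_field p" "u \<in> X" "v \<in> X"
  shows "(u, v) \<in> padic_rel p"
  using in_quotient_imp_in_rel[OF equiv_padic_rel] assms unfolding padic_field_def by blast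

lemma padic_field_Cauchy: "X \<in> padic_field p \<Longrightarrow> u \<in> X \<Longrightarrow> padic_Cauchy p u"
  using padic_field_rel[of X u u] by (simp add: padic_rel_iff)

lemma padic_field_nonempty:
  assumes "X \<in> padic_field p"
  obtains u where "u \<in> X"
  using in_quotient_imp_non_empty[OF equiv_padic_rel] assms unfolding padic_field_def by blast

text \<open>This justifies the definite description in \<open>padic_dist\<close>: the limit exists
  by completeness of the reals, and changing representatives alters the sequence by a null
  sequence.\<close>

lemma padic_dist_tendsto:
  assumes X: "X \<in> padic_field p" and Y: "Y \<in> padic_field p" and u: "u \<in> X" and v: "v \<in> Y"
  shows "(\<lambda>n. pabs (u n - v n)) \<longlonglongrightarrow> padic_dist p X Y"
proof -
  obtain d where d: "(\<lambda>n. pabs (u n - v n)) \<longlonglongrightarrow> d"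
    using padic_Cauchy_convergent[OF padic_field_Cauchy[OF X u] padic_field_Cauchy[OF Y v]]
    by (auto simp: convergent_def)
  have "padic_dist p X Y = d"
    unfolding padic_dist_def
  proof (rule the_equality)
    show "\<exists>u\<in>X. \<exists>v\<in>Y. (\<lambda>n. pabs (u n - v n)) \<longlonglongrightarrow> d" using u v d by blast
    fix d' assume "\<exists>u\<in>X. \<exists>v\<in>Y. (\<lambda>n. pabs (u n - v n)) \<longlonglongrightarrow> d'"
    then obtain u' v' where u': "u' \<in> X" and v': "v' \<in> Y"
      and d': "(\<lambda>n. pabs (u' n - v' n)) \<longlonglongrightarrow> d'" by blast
    have uu: "(\<lambda>n. pabs (u n - u' n)) \<longlonglongrightarrow> 0" and vv: "(\<lambda>n. pabs (v n - v' n)) \<longlonglongrightarrow> 0"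
      using padic_field_rel[OF X u u'] padic_field_rel[OF Y v v'] by (auto simp: padic_rel_iff)
    have "(\<lambda>n. pabs (u n - v n) - pabs (u' n - v' n)) \<longlonglongrightarrow> 0"
    proof (rule tendsto_0_le[OF tendsto_add_zero[OF uu vv], where K = 1], rule always_eventually, rule allI)
      fix n
      have "norm (pabs (u n - v n) - pabs (u' n - v' n)) \<le> pabs ((u n - v n) - (u' n - v' n))"
        using padic_abs_diff_abs by simp
      also have "\<dots> = pabs ((u n - u' n) - (v n - v' n))"
        by (simp add: algebra_simps)
      also have "\<dots> \<le> max (pabs (u n - u' n)) (pabs (v n - v' n))"
        by (rule padic_abs_diff)
      also have "\<dots> \<le> pabs (u n - u' n) + pabs (v n - v' n)" by simp
      finally show "norm (pabs (u n - v n) - pabs (u' n - v' n)) \<le>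
          norm (pabs (u n - u' n) + pabs (v n - v' n)) * 1" by simp
    qed
    moreover have "(\<lambda>n. pabs (u n - v n) - pabs (u' n - v' n)) \<longlonglongrightarrow> d - d'"
      by (intro tendsto_diff d d')
    ultimately show "d' = d" using LIMSEQ_unique by fastforce
  qed
  then show ?thesis using d by simp
qed

lemma padic_of_rat_in_field [simp]: "padic_of_rat p q \<in> padic_field p"
  unfolding padic_of_rat_def padic_field_def by (rule quotientI) (simp add: padic_Cauchy_const)

lemma const_in_padic_of_rat [simp]: "(\<lambda>_. q) \<in> padic_of_rat p q"
  by (simp add: padic_of_rat_def padic_rel_iff padic_Cauchy_const)

lemma padic_dist_nonneg:
  assumes "X \<in> padic_field p" "Y \<in> padic_field p"
  shows "0 \<le> padic_dist p X Y"
proof -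
  obtain u v where "u \<in> X" "v \<in> Y" using assms by (meson padic_field_nonempty)
  from LIMSEQ_le_const[OF padic_dist_tendsto[OF assms this]] show ?thesis by simp
qed

lemma padic_dist_commute:
  assumes "X \<in> padic_field p" "Y \<in> padic_field p"
  shows "padic_dist p X Y = padic_dist p Y X"
proof -
  obtain u v where u: "u \<in> X" and v: "v \<in> Y" using assms by (meson padic_field_nonempty)
  have "(\<lambda>n. pabs (u n - v n)) \<longlonglongrightarrow> padic_dist p Y X"
    using padic_dist_tendsto[OF assms(2,1) v u] by (simp add: padic_abs_minus_commute)
  with padic_dist_tendsto[OF assms u v] show ?thesis by (rule LIMSEQ_unique)
qed

lemma padic_dist_triangle:
  assumes "X \<in> padic_field p" "Y \<in> padic_field p" "Z \<in> padic_field p"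
  shows "padic_dist p X Z \<le> padic_dist p X Y + padic_dist p Y Z"
proof -
  obtain u v w where "u \<in> X" "v \<in> Y" "w \<in> Z" using assms by (meson padic_field_nonempty)
  then show ?thesis
    using assms
    by (intro LIMSEQ_le[OF padic_dist_tendsto[of X Z u w]
          tendsto_add[OF padic_dist_tendsto[of X Y u v] padic_dist_tendsto[of Y Z v w]]])
      (auto intro: padic_abs_triangle_add)
qed

lemma padic_dist_eq_0:
  assumes "X \<in> padic_field p" "Y \<in> padic_field p" "padic_dist p X Y = 0"
  shows "X = Y"
proof -
  obtain u v where uv: "u \<in> X" "v \<in> Y" using assms by (meson padic_field_nonempty)
  then have "(u, v) \<in> padic_rel p"
    using padic_dist_tendsto[OF assms(1,2) uv] padic_field_Cauchy assms by (auto simp: padic_rel_iff)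
  then show ?thesis
    using quotient_eqI[OF equiv_padic_rel] assms(1,2) uv unfolding padic_field_def by blast
qed

lemma padic_dist_of_rat: "padic_dist p (padic_of_rat p q) (padic_of_rat p r) = pabs (q - r)"
  using padic_dist_tendsto[of "padic_of_rat p q" "padic_of_rat p r" "\<lambda>_. q" "\<lambda>_. r"]
  by (simp add: LIMSEQ_const_iff)

lemma padic_tendsto_of_rat_unique:
  assumes x: "x \<in> padic_field p" and s: "padic_tendsto p (\<lambda>n. padic_of_rat p (s n)) x"
    and q: "(\<lambda>n. pabs (q - s n)) \<longlonglongrightarrow> 0"
  shows "x = padic_of_rat p q"
proof -
  have "(\<lambda>n. pabs (q - s n) + padic_dist p (padic_of_rat p (s n)) x) \<longlonglongrightarrow> 0"
    using tendsto_add_zero[OF q s[unfolded padic_tendsto_def]] .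
  moreover have "padic_dist p (padic_of_rat p q) x \<le>
      pabs (q - s n) + padic_dist p (padic_of_rat p (s n)) x" for n
    using padic_dist_triangle[of "padic_of_rat p q" "padic_of_rat p (s n)" x] x
    by (simp add: padic_dist_of_rat)
  ultimately have "padic_dist p (padic_of_rat p q) x \<le> 0"
    by (intro LIMSEQ_le_const) auto
  then have "padic_dist p (padic_of_rat p q) x = 0"
    using padic_dist_nonneg[of "padic_of_rat p q" x] x by simp
  then show ?thesis using padic_dist_eq_0[of "padic_of_rat p q" x] x by simp
qed

text \<open>The link to the main argument: values that are unbounded along the truncations cannot
  converge.\<close>

lemma padic_tendsto_bounded:
  assumes L: "L \<in> padic_field p" and s: "padic_tendsto p (\<lambda>n. padic_of_rat p (s n)) L"
  obtains C N where "0 < C" "\<And>n. n \<ge> N \<Longrightarrow> pabs (s n) \<le> C"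
proof -
  define C where "C = 1 + padic_dist p L (padic_of_rat p 0)"
  have "\<forall>\<^sub>F n in sequentially. padic_dist p (padic_of_rat p (s n)) L < 1"
    using s unfolding padic_tendsto_def by (rule order_tendstoD) simp
  then obtain N where N: "\<And>n. n \<ge> N \<Longrightarrow> padic_dist p (padic_of_rat p (s n)) L < 1"
    by (auto simp: eventually_sequentially)
  have "pabs (s n) \<le> C" if "n \<ge> N" for n
    using padic_dist_triangle[of "padic_of_rat p (s n)" L "padic_of_rat p 0"] N[OF that] L
    by (simp add: padic_dist_of_rat C_def)
  moreover have "0 < C"
    using padic_dist_nonneg[of L "padic_of_rat p 0"] L by (simp add: C_def)
  ultimately show ?thesis using that by blast
qed

text \<open>The bound is exclusive, so that n digits give a number below p^n; the truncation x_n is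
  therefore the value at \<open>Suc n\<close>.\<close>

definition digit_sum :: "(nat \<Rightarrow> nat) \<Rightarrow> nat \<Rightarrow> nat" where
  "digit_sum \<epsilon> n = (\<Sum>i<n. \<epsilon> i * p ^ i)"

lemma digit_sum_Suc: "digit_sum \<epsilon> (Suc n) = digit_sum \<epsilon> n + \<epsilon> n * p ^ n"
  by (simp add: digit_sum_def)

lemma add_digit_less:
  assumes "c < p ^ n" "e < p"
  shows "c + e * p ^ n < p ^ Suc n"
proof -
  have "c + e * p ^ n < Suc e * p ^ n" using assms(1) by simp
  also have "\<dots> \<le> p * p ^ n" using assms(2) by (intro mult_right_mono) auto
  finally show ?thesis by simp
qed

lemma digit_sum_less:
  assumes "\<And>i. \<epsilon> i < p"
  shows "digit_sum \<epsilon> n < p ^ n"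
proof (induction n)
  case (Suc n)
  then show ?case unfolding digit_sum_Suc using assms by (rule add_digit_less)
qed (simp add: digit_sum_def)

lemma digit_sum_cong:
  assumes "k \<le> n"
  shows "[digit_sum \<epsilon> n = digit_sum \<epsilon> k] (mod p ^ k)"
  using assms
proof (induction n rule: dec_induct)
  case (step n)
  have "[\<epsilon> n * p ^ n = 0] (mod p ^ k)"
    using step by (auto simp: cong_0_iff intro: dvd_mult le_imp_power_dvd)
  then show ?case
    unfolding digit_sum_Suc using step cong_add by fastforce
qed simp

lemma digit_sum_mod:
  assumes "\<And>i. \<epsilon> i < p" "k \<le> n"
  shows "digit_sum \<epsilon> n mod p ^ k = digit_sum \<epsilon> k"
  using digit_sum_cong[OF assms(2), of \<epsilon>] digit_sum_less[of \<epsilon> k] assms(1) by (simp add: cong_def)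

lemma padic_abs_of_nat_diff_le_iff:
  "pabs (of_nat a - of_nat b) \<le> 1 / real p ^ k \<longleftrightarrow> [a = b] (mod p ^ k)"
proof -
  have "pabs (of_nat a - of_nat b) \<le> 1 / real p ^ k \<longleftrightarrow> [int a = int b] (mod (int p ^ k))"
    using pcong_of_int_iff[of k "int a" "int b"] by (simp add: pcong_def)
  also have "\<dots> \<longleftrightarrow> [a = b] (mod p ^ k)"
    by (simp flip: cong_int_iff)
  finally show ?thesis .
qed

text \<open>The reduced denominator of a p-integral rational is prime to p and hence invertible
  modulo p^k.\<close>

lemma padic_residue_exists:
  assumes "pabs q \<le> 1"
  obtains a where "a < p ^ k" "pabs (q - of_nat a) \<le> 1 / real p ^ k"
proof -
  obtain n d where nd: "quotient_of q = (n, d)" by fastforce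
  have q: "q = of_int n / of_int d" using quotient_of_div[OF nd] .
  have d: "d > 0" using quotient_of_denom_pos[OF nd] .
  have cop: "coprime n d" using quotient_of_coprime[OF nd] .
  have d_unit: "\<not> int p dvd d"
  proof
    assume dv: "int p dvd d"
    then have "\<not> int p dvd n"
      using cop prime_int_p not_prime_unit coprime_common_divisor by blast
    then have "pabs q = 1 / pabs (of_int d)"
      by (simp add: q padic_abs_divide padic_abs_of_int_unit)
    moreover have "pabs (of_int d) \<le> 1 / real p"
      using dv padic_abs_of_int_le_iff[of d 1] by simp
    moreover have "pabs (of_int d) > 0" using d by (intro padic_abs_pos) simp
    moreover have "1 / real p < 1" using p_gt_1 by simp
    ultimately show False using assms by (simp add: divide_le_eq_1)
  qed
  have "coprime d (int p)"
    using prime_imp_coprime[OF prime_int_p d_unit] by (rule coprime_imp_coprime) simp_all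
  then have "coprime d (int p ^ k)" by simp
  then obtain c where c: "[d * c = 1] (mod (int p ^ k))"
    using cong_solve_coprime_int by blast
  define a where "a = nat ((n * c) mod int p ^ k)"
  have pk: "0 < int p ^ k" using p_gt_1 by simp
  have a: "int a = (n * c) mod int p ^ k" using pk by (simp add: a_def)
  have "[d * int a = d * (n * c)] (mod (int p ^ k))"
    by (intro cong_scalar_left) (simp add: a cong_def)
  also have "[d * (n * c) = n] (mod (int p ^ k))"
    using cong_scalar_left[OF c, of n] by (simp add: algebra_simps)
  finally have "pcong k (of_int n) (of_int (d * int a))"
    unfolding pcong_of_int_iff by (rule cong_sym)
  then have "pcong k (of_int n / of_int d) (of_int (d * int a) / of_int d)"
    using padic_abs_of_int_unit[OF d_unit] by (rule pcong_unit_divide)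
  then have "pabs (q - of_nat a) \<le> 1 / real p ^ k"
    using d by (simp add: q pcong_def)
  moreover have "int a < int p ^ k" unfolding a using pk by simp
  then have "a < p ^ k" by (simp flip: of_nat_power)
  ultimately show ?thesis using that by blast
qed

lemma padic_integers_residue:
  assumes x: "x \<in> padic_integers p" and u: "u \<in> x"
  shows "\<exists>a. a < p ^ k \<and> (\<forall>\<^sub>F n in sequentially. pabs (u n - of_nat a) \<le> 1 / real p ^ k)"
proof -
  have xf: "x \<in> padic_field p" and x1: "padic_dist p x (padic_of_rat p 0) \<le> 1"
    using x by (auto simp: padic_integers_def)
  have "(\<lambda>n. pabs (u n - 0)) \<longlonglongrightarrow> padic_dist p x (padic_of_rat p 0)"
    by (rule padic_dist_tendsto[OF xf padic_of_rat_in_field u const_in_padic_of_rat])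
  then have "\<forall>\<^sub>F n in sequentially. pabs (u n - 0) < real p"
    using x1 p_gt_1 by (intro order_tendstoD) auto
  then obtain N where N: "\<And>n. n \<ge> N \<Longrightarrow> pabs (u n) < real p"
    by (auto simp: eventually_sequentially)
  have pk: "0 < 1 / real p ^ k" using p_gt_1 by simp
  obtain K where K: "\<And>m n. m \<ge> K \<Longrightarrow> n \<ge> K \<Longrightarrow> pabs (u m - u n) < 1 / real p ^ k"
    using padic_CauchyD[OF padic_field_Cauchy[OF xf u] pk] by blast
  define m where "m = max N K"
  \<comment> \<open>A limit of at most 1 only yields terms eventually below p; after scaling by p,
    discreteness of the values gives the bound 1.\<close>
  have "pabs (of_nat p * u m) < 1"
    using N[of m] p_gt_1 by (simp add: m_def padic_abs_mult)
  then have "pabs (u m) \<le> 1"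
    using padic_abs_less_1_imp_le[of "of_nat p * u m"] p_gt_1
    by (simp add: padic_abs_mult divide_le_cancel)
  then obtain a where a: "a < p ^ k" "pabs (u m - of_nat a) \<le> 1 / real p ^ k"
    by (rule padic_residue_exists)
  have "pabs (u n - of_nat a) \<le> 1 / real p ^ k" if "n \<ge> m" for n
    using padic_abs_diff_trans[OF less_imp_le[OF K[of n m]] a(2)] that by (simp add: m_def)
  then show ?thesis using a(1) by (auto simp: eventually_sequentially)
qed

lemma inverse_p_power_tendsto_0: "(\<lambda>n. (1 / real p) ^ Suc n) \<longlonglongrightarrow> 0"
  by (rule LIMSEQ_Suc[OF LIMSEQ_power_zero]) (use p_gt_1 in simp)

text \<open>The residues of x modulo successive powers p^k are nested, and the quotient of the
  difference of two neighbours by p^k is the next digit.\<close>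

lemma padic_digits_exist:
  assumes x: "x \<in> padic_integers p"
  shows "\<exists>\<epsilon>. (\<forall>i. \<epsilon> i \<in> {0..<p}) \<and>
    padic_tendsto p (\<lambda>n. padic_of_rat p (of_nat (\<Sum>i\<le>n. \<epsilon> i * p ^ i))) x"
proof -
  have xf: "x \<in> padic_field p" using x by (simp add: padic_integers_def)
  then obtain u where u: "u \<in> x" by (rule padic_field_nonempty)
  obtain a where a: "\<And>k. a k < p ^ k"
    and ua: "\<And>k. \<forall>\<^sub>F n in sequentially. pabs (u n - of_nat (a k)) \<le> 1 / real p ^ k"
    using padic_integers_residue[OF x u] by metis
  define \<epsilon> where "\<epsilon> k = a (Suc k) div p ^ k" for k
  have \<epsilon>: "\<epsilon> k < p" for k
    using a[of "Suc k"] by (simp add: \<epsilon>_def less_mult_imp_div_less)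
  have "a (Suc k) mod p ^ k = a k" for k
  proof -
    have "\<forall>\<^sub>F n in sequentially. pabs (u n - of_nat (a (Suc k))) \<le> 1 / real p ^ Suc k \<and>
        pabs (u n - of_nat (a k)) \<le> 1 / real p ^ k"
      by (intro eventually_conj ua)
    then obtain n where n: "pabs (u n - of_nat (a (Suc k))) \<le> 1 / real p ^ Suc k"
      "pabs (u n - of_nat (a k)) \<le> 1 / real p ^ k"
      by (auto dest: eventually_happens)
    have "1 / real p ^ Suc k \<le> 1 / real p ^ k"
      using p_gt_1 by (intro divide_left_mono power_increasing) auto
    then have "pabs (of_nat (a (Suc k)) - u n) \<le> 1 / real p ^ k"
      using n(1) padic_abs_minus_commute[of "u n"] by simp
    then have "pabs (of_nat (a (Suc k)) - of_nat (a k)) \<le> 1 / real p ^ k"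
      using n(2) by (rule padic_abs_diff_trans)
    then show ?thesis
      unfolding padic_abs_of_nat_diff_le_iff using a[of k] by (simp add: cong_def)
  qed
  then have a_Suc: "a (Suc k) = a k + \<epsilon> k * p ^ k" for k
    using mod_div_mult_eq[of "a (Suc k)" "p ^ k"] by (simp add: \<epsilon>_def)
  have a_sum: "(\<Sum>i\<le>n. \<epsilon> i * p ^ i) = a (Suc n)" for n
  proof (induction n)
    case 0
    then show ?case using a_Suc[of 0] a[of 0] by simp
  next
    case (Suc n)
    then show ?case using a_Suc[of "Suc n"] by simp
  qed
  have "padic_dist p (padic_of_rat p (of_nat (a (Suc n)))) x \<le> 1 / real p ^ Suc n" for n
  proof (rule tendsto_upperbound[OF padic_dist_tendsto[OF padic_of_rat_in_field xf const_in_padic_of_rat u]])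
    show "\<forall>\<^sub>F m in sequentially. pabs (of_nat (a (Suc n)) - u m) \<le> 1 / real p ^ Suc n"
      using ua[of "Suc n"] by (simp only: padic_abs_minus_commute)
  qed simp
  then have le: "padic_dist p (padic_of_rat p (of_nat (a (Suc n)))) x \<le> (1 / real p) ^ Suc n" for n
    by (simp only: power_one_over)
  have "(\<lambda>n. padic_dist p (padic_of_rat p (of_nat (a (Suc n)))) x) \<longlonglongrightarrow> 0"
  proof (rule tendsto_sandwich[OF _ _ tendsto_const inverse_p_power_tendsto_0])
    show "\<forall>\<^sub>F n in sequentially. 0 \<le> padic_dist p (padic_of_rat p (of_nat (a (Suc n)))) x"
      by (rule always_eventually) (use padic_dist_nonneg[OF padic_of_rat_in_field xf] in blast)
    show "\<forall>\<^sub>F n in sequentially. padic_dist p (padic_of_rat p (of_nat (a (Suc n)))) x \<le> (1 / real p) ^ Suc n"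
      by (rule always_eventually) (use le in blast)
  qed
  then have "padic_tendsto p (\<lambda>n. padic_of_rat p (of_nat (\<Sum>i\<le>n. \<epsilon> i * p ^ i))) x"
    by (simp add: padic_tendsto_def a_sum)
  then show ?thesis using \<epsilon> by auto
qed

lemma padic_digits_unique:
  assumes x: "x \<in> padic_field p" and \<epsilon>: "\<And>i. \<epsilon> i < p" and \<delta>: "\<And>i. \<delta> i < p"
    and s: "padic_tendsto p (\<lambda>n. padic_of_rat p (of_nat (digit_sum \<epsilon> (Suc n)))) x"
    and t: "padic_tendsto p (\<lambda>n. padic_of_rat p (of_nat (digit_sum \<delta> (Suc n)))) x"
  shows "\<epsilon> = \<delta>"
proof -
  have eq: "digit_sum \<epsilon> k = digit_sum \<delta> k" for k
  proof -
    have "(\<lambda>n. padic_dist p (padic_of_rat p (of_nat (digit_sum \<epsilon> (Suc n)))) x +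
        padic_dist p (padic_of_rat p (of_nat (digit_sum \<delta> (Suc n)))) x) \<longlonglongrightarrow> 0"
      using tendsto_add_zero[OF s[unfolded padic_tendsto_def] t[unfolded padic_tendsto_def]] .
    then have "\<forall>\<^sub>F n in sequentially. padic_dist p (padic_of_rat p (of_nat (digit_sum \<epsilon> (Suc n)))) x +
        padic_dist p (padic_of_rat p (of_nat (digit_sum \<delta> (Suc n)))) x < 1 / real p ^ k"
      by (rule order_tendstoD) (use p_gt_1 in simp)
    then have "\<forall>\<^sub>F n in sequentially. padic_dist p (padic_of_rat p (of_nat (digit_sum \<epsilon> (Suc n)))) x +
        padic_dist p (padic_of_rat p (of_nat (digit_sum \<delta> (Suc n)))) x < 1 / real p ^ k \<and> k \<le> n"
      by (intro eventually_conj eventually_ge_at_top)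
    then obtain n where n: "padic_dist p (padic_of_rat p (of_nat (digit_sum \<epsilon> (Suc n)))) x +
        padic_dist p (padic_of_rat p (of_nat (digit_sum \<delta> (Suc n)))) x < 1 / real p ^ k" "k \<le> n"
      by (auto dest: eventually_happens)
    have "pabs (of_nat (digit_sum \<epsilon> (Suc n)) - of_nat (digit_sum \<delta> (Suc n))) \<le>
        padic_dist p (padic_of_rat p (of_nat (digit_sum \<epsilon> (Suc n)))) x +
        padic_dist p x (padic_of_rat p (of_nat (digit_sum \<delta> (Suc n))))"
      unfolding padic_dist_of_rat[symmetric]
      by (rule padic_dist_triangle[OF padic_of_rat_in_field x padic_of_rat_in_field])
    also have "\<dots> \<le> 1 / real p ^ k"
      using n(1) padic_dist_commute[OF x padic_of_rat_in_field] by simp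
    finally have "[digit_sum \<epsilon> (Suc n) = digit_sum \<delta> (Suc n)] (mod p ^ k)"
      unfolding padic_abs_of_nat_diff_le_iff .
    then show ?thesis
      using digit_sum_mod[of \<epsilon> k "Suc n"] digit_sum_mod[of \<delta> k "Suc n"] \<epsilon> \<delta> n(2)
      by (simp add: cong_def)
  qed
  have "\<epsilon> k * p ^ k = \<delta> k * p ^ k" for k
    using eq[of "Suc k"] eq[of k] by (simp add: digit_sum_Suc)
  then show ?thesis using p_gt_1 by auto
qed

lemma digit_sum_Suc_eq: "digit_sum \<epsilon> (Suc n) = (\<Sum>i\<le>n. \<epsilon> i * p ^ i)"
  by (simp add: digit_sum_def lessThan_Suc_atMost)

lemma padic_digits:
  assumes x: "x \<in> padic_integers p"
  shows "padic_digits p x i < p"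
    and "padic_tendsto p (\<lambda>n. padic_of_rat p (of_nat (padic_trunc p x n))) x"
proof -
  have xf: "x \<in> padic_field p" using x by (simp add: padic_integers_def)
  have "\<exists>!\<epsilon>. (\<forall>i. \<epsilon> i \<in> {0..<p}) \<and>
    padic_tendsto p (\<lambda>n. padic_of_rat p (of_nat (\<Sum>i\<le>n. \<epsilon> i * p ^ i))) x"
    using padic_digits_exist[OF x] padic_digits_unique[OF xf] unfolding digit_sum_Suc_eq by auto
  from theI'[OF this] show "padic_digits p x i < p"
    and "padic_tendsto p (\<lambda>n. padic_of_rat p (of_nat (padic_trunc p x n))) x"
    unfolding padic_trunc_def padic_digits_def[symmetric] by auto
qed

lemma padic_trunc_eq: "padic_trunc p x n = digit_sum (padic_digits p x) (Suc n)"
  by (simp add: padic_trunc_def digit_sum_Suc_eq)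

section \<open>Unboundedness\<close>

text \<open>A digit below p - 1 absorbs the carry from adding 1, so the digits above position k
  remain those of x.\<close>

lemma digit_sum_plus_one_less:
  assumes \<epsilon>: "\<And>i. \<epsilon> i < p" and k: "\<epsilon> k \<noteq> p - 1" and "k < n"
  shows "digit_sum \<epsilon> n + 1 < p ^ n"
  using \<open>k < n\<close>
proof (induction n rule: less_induct)
  case (less n)
  then obtain m where m: "n = Suc m" by (cases n) auto
  show ?case
  proof (cases "m = k")
    case True
    have "Suc (\<epsilon> k) < p" using \<epsilon>[of k] k by simp
    then have "digit_sum \<epsilon> k + Suc (\<epsilon> k) * p ^ k < p ^ Suc k"
      by (intro add_digit_less digit_sum_less \<epsilon>)
    moreover have "1 \<le> p ^ k" using p_gt_1 by simp
    ultimately show ?thesis by (simp add: m True digit_sum_Suc)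
  next
    case False
    then have "digit_sum \<epsilon> m + 1 < p ^ m" using less m by simp
    then have "digit_sum \<epsilon> m + 1 + \<epsilon> m * p ^ m < p ^ Suc m"
      using \<epsilon> by (rule add_digit_less)
    then show ?thesis by (simp add: m digit_sum_Suc)
  qed
qed

text \<open>Modulo p^(k+1) the number depends only on the digits up to k, and its residue there is
  nonzero; the bound is thus uniform in n.\<close>

lemma padic_abs_Suc_digit_sum:
  assumes \<epsilon>: "\<And>i. \<epsilon> i < p" and k: "\<epsilon> k \<noteq> p - 1" and "k < n"
  shows "1 / real p ^ Suc k < pabs (of_nat (Suc (digit_sum \<epsilon> n)))"
proof -
  have "[Suc (digit_sum \<epsilon> n) = Suc (digit_sum \<epsilon> (Suc k))] (mod p ^ Suc k)"
    using digit_sum_cong[of "Suc k" n \<epsilon>] \<open>k < n\<close> cong_add_rcancel_nat[of _ 1] by simp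
  moreover have "Suc (digit_sum \<epsilon> (Suc k)) < p ^ Suc k"
    using digit_sum_plus_one_less[of \<epsilon> k "Suc k"] \<epsilon> k by simp
  ultimately have "\<not> [Suc (digit_sum \<epsilon> n) = 0] (mod p ^ Suc k)"
    by (simp add: cong_def del: power_Suc)
  then have "\<not> pabs (of_nat (Suc (digit_sum \<epsilon> n)) - of_nat 0) \<le> 1 / real p ^ Suc k"
    unfolding padic_abs_of_nat_diff_le_iff .
  then show ?thesis by simp
qed

lemma unbounded_trunc_log:
  assumes p: "(good_prime p \<and> odd p) \<or> p = 23"
    and \<epsilon>: "\<And>i. \<epsilon> i < p" and k: "\<epsilon> k \<noteq> p - 1" and nz: "\<And>m. \<exists>n\<ge>m. \<epsilon> n \<noteq> 0"
  shows "\<exists>n\<ge>m. real p ^ m \<le> pabs (trunc_log 2 (Suc (digit_sum \<epsilon> (Suc n))))"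
proof -
  define M where "M n = Suc (digit_sum \<epsilon> (Suc n))" for n
  \<comment> \<open>Large enough that no carry reaches position r, that p^r is at least p^m, and
    that r is positive. Taking n at least r + 2 leaves three digits at or above position r.\<close>
  define r where "r = m + k + 2"
  obtain n where n: "r + 2 \<le> n" "\<epsilon> n \<noteq> 0" using nz by blast
  have less: "Suc (digit_sum \<epsilon> j) < p ^ j" if "r \<le> j" for j
    using digit_sum_plus_one_less[of \<epsilon> k j] \<epsilon> k that by (simp add: r_def)
  have div_eq: "N div p ^ j = c" if "N = Suc (digit_sum \<epsilon> j) + p ^ j * c" "r \<le> j" for N c j
  proof -
    have "p ^ j \<noteq> 0" using p_gt_1 by simp
    then show ?thesis
      using less[OF that(2)] unfolding that(1)
      by (simp only: div_mult_self2 div_less add_0_right simp_thms)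
  qed
  have M0: "M j div p ^ j = \<epsilon> j" if "r \<le> j" for j
    using that by (intro div_eq) (simp_all add: M_def digit_sum_Suc)
  have M1: "M (Suc j) div p ^ j = p * \<epsilon> (Suc j) + \<epsilon> j" if "r \<le> j" for j
    using that by (intro div_eq) (simp_all add: M_def digit_sum_Suc algebra_simps)
  have M2: "M (Suc (Suc j)) div p ^ j = p * (p * \<epsilon> (Suc (Suc j)) + \<epsilon> (Suc j)) + \<epsilon> j"
    if "r \<le> j" for j
    using that by (intro div_eq) (simp_all add: M_def digit_sum_Suc algebra_simps)
  obtain j where j: "n = Suc (Suc j)" "r \<le> j"
  proof
    show "n = Suc (Suc (n - 2))" "r \<le> n - 2" using n(1) by simp_all
  qed
  have large: "\<exists>n\<ge>m. real p ^ m \<le> pabs (trunc_log 2 (M n))"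
    if "real p ^ i \<le> pabs (trunc_log 2 (M l))" "r \<le> i" "r \<le> l" for i l
  proof (intro exI conjI)
    show "m \<le> l" using that(3) by (simp add: r_def)
    have "real p ^ m \<le> real p ^ i"
      using p_gt_1 that(2) by (intro power_increasing) (auto simp: r_def)
    also note that(1)
    finally show "real p ^ m \<le> pabs (trunc_log 2 (M l))" .
  qed
  from p have "\<exists>n\<ge>m. real p ^ m \<le> pabs (trunc_log 2 (M n))"
  proof
    assume good: "good_prime p \<and> odd p"
    \<comment> \<open>Which of the two consecutive truncations is the large one stays open, but
      either index is at least m, and that is all that is required.\<close>
    have "real p ^ Suc j \<le> pabs (trunc_log 2 (M n)) \<or>
        real p ^ Suc j \<le> pabs (trunc_log 2 (M (Suc j)))"
      using good M1[of "Suc j"] M0[of "Suc j"] n(2) j \<epsilon>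
      by (intro large_if_good[of _ _ "\<epsilon> n" "\<epsilon> (Suc j)"]) simp_all
    then show ?thesis
      using large[of "Suc j" n] large[of "Suc j" "Suc j"] j by auto
  next
    assume p23: "p = 23"
    show ?thesis
    proof (cases "\<epsilon> n = 13")
      case True
      obtain i where i: "j = Suc i" using j(2) by (cases j) (auto simp: r_def)
      have "M n div p ^ Suc i = p * (p * 13 + \<epsilon> (Suc j)) + \<epsilon> j"
        using M2[OF j(2)] True j(1) by (simp only: i)
      then have "real p ^ Suc i \<le> pabs (trunc_log 2 (M n))"
        by (rule large_23[OF p23 _ \<epsilon> \<epsilon>])
      then show ?thesis using large[of j n] i j by simp
    next
      case False
      have "1 \<le> pabs (trunc_log 2 (\<epsilon> n))"
        using n(2) \<epsilon> False by (intro trunc_log_23_unit[OF p23]) simp_all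
      then have "real p ^ n \<le> pabs (trunc_log 2 (M n))"
        using M0[of n] j by (intro large_if_leading_digit[OF _ \<epsilon>]) simp_all
      then show ?thesis using large[of n n] j by simp
    qed
  qed
  then show ?thesis unfolding M_def .
qed

lemma not_p_definable:
  assumes p: "(good_prime p \<and> odd p) \<or> p = 23"
    and x: "x \<in> padic_integers p" and not_int: "\<And>k. k \<ge> -1 \<Longrightarrow> x \<noteq> padic_of_rat p (of_int k)"
  shows "\<not> p_definable p inv_binom_sum x"
proof
  assume "p_definable p inv_binom_sum x"
  then obtain L where L: "L \<in> padic_field p"
    and lim: "padic_tendsto p (\<lambda>n. padic_of_rat p (inv_binom_sum (padic_trunc p x n))) L"
    by (auto simp: p_definable_def)
  obtain C N where C: "0 < C" and bound: "\<And>n. n \<ge> N \<Longrightarrow> pabs (inv_binom_sum (padic_trunc p x n)) \<le> C"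
    using padic_tendsto_bounded[OF L lim] by blast
  define \<epsilon> where "\<epsilon> = padic_digits p x"
  have xf: "x \<in> padic_field p" using x by (simp add: padic_integers_def)
  have \<epsilon>: "\<epsilon> i < p" for i using padic_digits(1)[OF x] by (simp add: \<epsilon>_def)
  have trunc: "padic_trunc p x n = digit_sum \<epsilon> (Suc n)" for n
    by (simp add: padic_trunc_eq \<epsilon>_def)
  have conv: "padic_tendsto p (\<lambda>n. padic_of_rat p (of_nat (digit_sum \<epsilon> (Suc n)))) x"
    using padic_digits(2)[OF x] by (simp add: trunc)
  have nz: "\<exists>n\<ge>m. \<epsilon> n \<noteq> 0" for m
  proof (rule ccontr)
    assume "\<not> (\<exists>n\<ge>m. \<epsilon> n \<noteq> 0)"
    then have z: "\<epsilon> n = 0" if "n \<ge> m" for n using that by blast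
    have const: "digit_sum \<epsilon> n = digit_sum \<epsilon> m" if "m \<le> n" for n
      using that by (induction n rule: dec_induct) (simp_all add: digit_sum_Suc z)
    have "\<forall>\<^sub>F n in sequentially. pabs (of_nat (digit_sum \<epsilon> m) - of_nat (digit_sum \<epsilon> (Suc n))) = 0"
    proof (rule eventually_sequentiallyI[of m])
      fix n assume "m \<le> n"
      then have "digit_sum \<epsilon> (Suc n) = digit_sum \<epsilon> m" by (intro const) simp
      then show "pabs (of_nat (digit_sum \<epsilon> m) - of_nat (digit_sum \<epsilon> (Suc n))) = 0" by simp
    qed
    then have "(\<lambda>n. pabs (of_nat (digit_sum \<epsilon> m) - of_nat (digit_sum \<epsilon> (Suc n)))) \<longlonglongrightarrow> 0"
      by (rule tendsto_eventually)
    with xf conv have "x = padic_of_rat p (of_nat (digit_sum \<epsilon> m))"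
      by (rule padic_tendsto_of_rat_unique)
    then show False using not_int[of "int (digit_sum \<epsilon> m)"] by simp
  qed
  have "\<exists>k. \<epsilon> k \<noteq> p - 1"
  proof (rule ccontr)
    assume "\<not> (\<exists>k. \<epsilon> k \<noteq> p - 1)"
    \<comment> \<open>The truncations are then p^(n+1) - 1 and converge to -1.\<close>
    then have e: "\<epsilon> k = p - 1" for k by blast
    have sum: "Suc (digit_sum \<epsilon> n) = p ^ n" for n
    proof (induction n)
      case (Suc n)
      have "Suc (digit_sum \<epsilon> (Suc n)) = p ^ n + (p - 1) * p ^ n"
        using Suc e[of n] by (simp add: digit_sum_Suc)
      also have "\<dots> = Suc (p - 1) * p ^ n" by simp
      finally show ?case using p_gt_1 by simp
    qed (simp add: digit_sum_def)
    have "pabs (- 1 - of_nat (digit_sum \<epsilon> (Suc n))) = (1 / real p) ^ Suc n" for n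
    proof -
      have "- 1 - of_nat (digit_sum \<epsilon> (Suc n)) = - (of_nat (Suc (digit_sum \<epsilon> (Suc n))) :: rat)"
        by simp
      then have "pabs (- 1 - of_nat (digit_sum \<epsilon> (Suc n))) = pabs (of_nat p ^ Suc n)"
        unfolding sum by (simp only: padic_abs_minus of_nat_power)
      then show ?thesis by (simp only: padic_abs_power padic_abs_p)
    qed
    then have "(\<lambda>n. pabs (- 1 - of_nat (digit_sum \<epsilon> (Suc n)))) \<longlonglongrightarrow> 0"
      using inverse_p_power_tendsto_0 by (simp only:)
    with xf conv have "x = padic_of_rat p (- 1)"
      by (rule padic_tendsto_of_rat_unique)
    then show False using not_int[of "-1"] by simp
  qed
  then obtain k where k: "\<epsilon> k \<noteq> p - 1" ..
  have odd: "odd p" using p by auto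
  \<comment> \<open>The bound on \<open>trunc_log 2\<close> that remains when
    \<open>pabs (inv_binom_sum n) \<le> C\<close> is divided by the lower bound p^-(k+1) for the
    factor n + 1.\<close>
  define B where "B = C * real p ^ Suc k"
  have upper: "pabs (trunc_log 2 (Suc (digit_sum \<epsilon> (Suc n)))) < B" if n: "N \<le> n" "k \<le> n" for n
  proof -
    let ?M = "Suc (digit_sum \<epsilon> (Suc n))"
    have M: "1 / real p ^ Suc k < pabs (of_nat ?M)"
      using padic_abs_Suc_digit_sum[of \<epsilon> k "Suc n"] \<epsilon> k n by simp
    have "pabs (of_nat ?M) * pabs (trunc_log 2 ?M) \<le> C"
      using bound[OF n(1)] unfolding trunc padic_abs_inv_binom_sum[OF odd] .
    show ?thesis
    proof (rule ccontr)
      assume "\<not> pabs (trunc_log 2 ?M) < B"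
      then have "(1 / real p ^ Suc k) * B < pabs (of_nat ?M) * pabs (trunc_log 2 ?M)"
        using M C p_gt_1
        by (intro mult_less_le_imp_less) (auto simp: B_def simp del: of_nat_Suc power_Suc)
      moreover have "(1 / real p ^ Suc k) * B = C" using p_gt_1 by (simp add: B_def)
      ultimately show False using \<open>pabs (of_nat ?M) * pabs (trunc_log 2 ?M) \<le> C\<close> by simp
    qed
  qed
  obtain r where r: "B < real p ^ r" using real_arch_pow[OF p_gt_1] by blast
  define m where "m = r + N + k"
  obtain n where n: "m \<le> n" "real p ^ m \<le> pabs (trunc_log 2 (Suc (digit_sum \<epsilon> (Suc n))))"
    using unbounded_trunc_log[of \<epsilon> k m] p \<epsilon> k nz by blast
  have "real p ^ r \<le> real p ^ m" using p_gt_1 by (intro power_increasing) (auto simp: m_def)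
  then show False using upper[of n] n r by (simp add: m_def)
qed

end

theorem theorem1p8:
  fixes p :: nat and x :: padic
  assumes "(good_prime p \<and> odd p) \<or> p = 23"
    and "x \<in> padic_integers p - {padic_of_rat p (of_int k) | k. k \<ge> -1}"
  shows "\<not> p_definable p inv_binom_sum x"
proof -
  have "prime (23::nat)" by simp
  then interpret prime_base p
    by unfold_locales (use assms(1) in \<open>auto simp: good_prime_def\<close>)
  show ?thesis
    using assms by (intro not_p_definable) auto
qed

end
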